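(* Let $\{X(t);t\ge 0\}$ be a (regular) weighted Markov branching process with $X(0)=1$ and $b_0>0$. Let $\tau=\inf\{t\ge0:X(t)=0\}$ and let $Y_0(\tau)$ be the death number until extinction. Then the probability generating function $G(v)=E[v^{Y_0(\tau)}\mid\tau<\infty]$ of the death number conditioned on $\tau<\infty$ is $$G(v)=\rho^{-1}\sum_{k=0}^\infty\rho_kv^k,$$ and hence $$P(Y_0(\tau)=k\mid\tau<\infty)=\rho^{-1}\rho_k,\qquad k\ge 0,$$ where $\rho$ is the minimal nonnegative root of $B(u)=0$, $\rho_0=0$, and $\rho_k$ $(k\ge1)$ are given by the recursion $$\rho_1=-b_1^{-1}b_0,\qquad \rho_{k+1}=-b_1^{-1}\sum_{j=2}^{k+1}b_j\,\rho^{*(j)}_{k+1},\quad k\ge 1.$$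
   Context: $\mathbb{Z}_+=\{0,1,2,\dots\}$. Fix real numbers $b_j$ $(j\ge 0)$ and $w_i$ $(i\ge 1)$ with $b_j\ge 0$ for $j\ne 1$, $0<-b_1=\sum_{j\ne 1}b_j<\infty$, and $w_i>0$. The weighted branching $Q$-matrix is $q_{ij}=w_ib_{j-i+1}$ if $i\ge 1$, $j\ge i-1$, and $q_{ij}=0$ otherwise $(i,j\in\mathbb{Z}_+)$. A weighted Markov branching process $X(t)$ is the continuous-time Markov chain on $\mathbb{Z}_+$ with this $Q$-matrix; it is assumed regular (non-explosive). State $0$ is absorbing. $Y_0(t)$ (the death number, or down crossing number) is the number of jumps of size $-1$ made by $X$ during $[0,t]$, $Y_0(0)=0$; $Y_0(\tau)$ is the total number of such jumps until extinction. $B(u)=\sum_{j\ge 0}b_ju^j$ for $u\in[0,1]$. Convolution powers: $\rho^{*(j)}_{n}=\sum_{l_1+\cdots+l_j=n}\rho_{l_1}\cdots\rho_{l_j}$ for $j\ge 1$, the sum being over $(l_1,\dots,l_j)\in\mathbb{Z}_+^j$ (since $\rho_0=0$, $\rho^{*(j)}_{k+1}$ with $j\ge2$ involves only $\rho_1,\dots,\rho_k$). *)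

theory Defs
  imports "HOL-Probability.Probability"
begin

text \<open>
  An honest transition function \<open>P t i j\<close> on \<open>nat\<close> with \<open>Q\<close>-matrix \<open>q\<close>.  The one-sided derivative at
  \<open>0\<close>, together with \<open>P 0 = I\<close>, contains the usual standardness condition.
\<close>

definition q_transition_function ::
    "(nat \<Rightarrow> nat \<Rightarrow> real) \<Rightarrow> (real \<Rightarrow> nat \<Rightarrow> nat \<Rightarrow> real) \<Rightarrow> bool" where
  "q_transition_function q P \<longleftrightarrow>
     (\<forall>t\<ge>0. \<forall>i j. P t i j \<ge> 0) \<and>
     (\<forall>t\<ge>0. \<forall>i. (P t i has_sum 1) UNIV) \<and>
     (\<forall>i j. P 0 i j = (if i = j then 1 else 0)) \<and>
     (\<forall>s\<ge>0. \<forall>t\<ge>0. \<forall>i j. ((\<lambda>k. P s i k * P t k j) has_sum P (s + t) i j) UNIV) \<and>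
     (\<forall>i j. ((\<lambda>t. P t i j) has_real_derivative q i j) (at 0 within {0..}))"

text \<open>
  A regular (non-explosive) continuous-time Markov chain on \<open>nat\<close> with \<open>Q\<close>-matrix \<open>q\<close>.  As usual for
  such chains every sample path is a right-continuous step function.  The state space being discrete,
  right continuity means being constant on some \<open>[t, t + \<epsilon>)\<close>, and the jump times of a path are the
  times at which it is not constant just to the left.  Non-explosion says that there are only
  finitely many of them in bounded time.  The process is indexed by all reals, but only times
  \<open>t \<ge> 0\<close> are meaningful.
\<close>

locale regular_ctmc = prob_space M
  for M :: "'a measure" and X :: "real \<Rightarrow> 'a \<Rightarrow> nat" and q :: "nat \<Rightarrow> nat \<Rightarrow> real" +
  assumes random_variable_X: "\<And>t. t \<ge> 0 \<Longrightarrow> X t \<in> M \<rightarrow>\<^sub>M count_space UNIV"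
    and right_continuous:
      "\<And>\<omega> t. \<omega> \<in> space M \<Longrightarrow> t \<ge> 0 \<Longrightarrow> \<forall>\<^sub>F s in at_right t. X s \<omega> = X t \<omega>"
    and non_explosive:
      "\<And>\<omega> t. \<omega> \<in> space M \<Longrightarrow> t \<ge> 0 \<Longrightarrow>
         finite {s \<in> {0<..t}. \<not> (\<forall>\<^sub>F r in at_left s. X r \<omega> = X s \<omega>)}"
    and markov:
      "\<exists>P. q_transition_function q P \<and>
         (\<forall>n (t :: nat \<Rightarrow> real) (i :: nat \<Rightarrow> nat).
            0 \<le> t 0 \<longrightarrow> (\<forall>m\<le>n. t m < t (Suc m)) \<longrightarrow>
            \<P>(\<omega> in M. \<forall>m\<le>Suc n. X (t m) \<omega> = i m) =
            \<P>(\<omega> in M. \<forall>m\<le>n. X (t m) \<omega> = i m) * P (t (Suc n) - t n) (i n) (i (Suc n)))"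

definition wmbp_Q :: "(nat \<Rightarrow> real) \<Rightarrow> (nat \<Rightarrow> real) \<Rightarrow> nat \<Rightarrow> nat \<Rightarrow> real" where
  "wmbp_Q w b i j = (if i \<ge> 1 \<and> j \<ge> i - 1 then w i * b (j + 1 - i) else 0)"

definition extinction_time :: "(real \<Rightarrow> 'a \<Rightarrow> nat) \<Rightarrow> 'a \<Rightarrow> ereal" where
  "extinction_time X \<omega> = (INF t \<in> {t. t \<ge> 0 \<and> X t \<omega> = 0}. ereal t)"

definition death_number :: "(real \<Rightarrow> 'a \<Rightarrow> nat) \<Rightarrow> real \<Rightarrow> 'a \<Rightarrow> nat" where
  "death_number X t \<omega> = card {s \<in> {0<..t}. \<forall>\<^sub>F r in at_left s. X r \<omega> = X s \<omega> + 1}"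

text \<open>Meaningful only where the extinction time is finite: \<open>real_of_ereal \<infinity> = 0\<close>.\<close>

definition total_death_number :: "(real \<Rightarrow> 'a \<Rightarrow> nat) \<Rightarrow> 'a \<Rightarrow> nat" where
  "total_death_number X \<omega> = death_number X (real_of_ereal (extinction_time X \<omega>)) \<omega>"

definition event_cond_exp :: "'a measure \<Rightarrow> ('a \<Rightarrow> real) \<Rightarrow> ('a \<Rightarrow> bool) \<Rightarrow> real" where
  "event_cond_exp M f A = (LINT \<omega>:{\<omega> \<in> space M. A \<omega>}|M. f \<omega>) / \<P>(\<omega> in M. A \<omega>)"

definition B_fun :: "(nat \<Rightarrow> real) \<Rightarrow> real \<Rightarrow> real" where
  "B_fun b u = (\<Sum>j. b j * u ^ j)"

text \<open>The search is restricted to \<open>[0, 1]\<close>, the domain of \<open>B\<close>.\<close>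

definition min_root :: "(nat \<Rightarrow> real) \<Rightarrow> real" where
  "min_root b = (LEAST u. 0 \<le> u \<and> u \<le> 1 \<and> B_fun b u = 0)"

definition conv_power :: "(nat \<Rightarrow> real) \<Rightarrow> nat \<Rightarrow> nat \<Rightarrow> real" where
  "conv_power f j n = (\<Sum>l | length l = j \<and> sum_list l = n. \<Prod>x\<leftarrow>l. f x)"

text \<open>
  Truncating the sequence below the current index makes the recursion visibly well-founded; by
  \<open>rho_seq_rec\<close> below it does not change the values.
\<close>

fun rho_seq :: "(nat \<Rightarrow> real) \<Rightarrow> nat \<Rightarrow> real" where
  "rho_seq b 0 = 0"
| "rho_seq b (Suc 0) = - inverse (b 1) * b 0"
| "rho_seq b (Suc (Suc k)) = - inverse (b 1) *
     (\<Sum>j = 2..k + 2. b j * conv_power (\<lambda>m. if m \<le> Suc k then rho_seq b m else 0) j (k + 2))"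

lemma conv_power_trunc:
  assumes "f 0 = 0" "j \<ge> 2"
  shows "conv_power (\<lambda>m. if m \<le> k then f m else 0) j (Suc k) = conv_power f j (Suc k)"
  unfolding conv_power_def
proof (rule sum.cong[OF refl], clarify)
  fix l :: "nat list"
  assume l: "sum_list l = Suc k" "j = length l"
  show "(\<Prod>x\<leftarrow>l. if x \<le> k then f x else 0) = (\<Prod>x\<leftarrow>l. f x)"
  proof (cases "0 \<in> set l")
    case True
    then show ?thesis
      using assms(1) by (auto simp: in_set_conv_decomp)
  next
    case False
    have "x \<le> k" if x: "x \<in> set l" for x
    proof -
      obtain ys zs where yz: "l = ys @ x # zs" using x by (auto simp: in_set_conv_decomp)
      then have "ys @ zs \<noteq> []" using l assms(2) by auto
      then obtain y where y: "y \<in> set (ys @ zs)" by (cases "ys @ zs") auto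
      then have "y \<in> set l" using yz by auto
      then have "y \<noteq> 0" using False by metis
      moreover have "y \<le> sum_list (ys @ zs)" using y by (intro member_le_sum_list) simp_all
      ultimately show ?thesis using l yz by simp
    qed
    then have "map (\<lambda>x. if x \<le> k then f x else 0) l = map f l" by (intro map_cong) simp_all
    then show ?thesis by (rule arg_cong)
  qed
qed

lemma rho_seq_rec:
  assumes "k \<ge> 1"
  shows "rho_seq b (k + 1) =
    - inverse (b 1) * (\<Sum>j = 2..k + 1. b j * conv_power (rho_seq b) j (k + 1))"
proof -
  obtain m where k: "k = Suc m" using assms by (cases k) auto
  have "conv_power (\<lambda>n. if n \<le> Suc m then rho_seq b n else 0) j (m + 2) =
        conv_power (rho_seq b) j (m + 2)" if "j \<in> {2..m + 2}" for j
  proof -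
    have "2 \<le> j" using that by simp
    from conv_power_trunc[of "rho_seq b", OF rho_seq.simps(1) this, of "Suc m"]
    show ?thesis by (simp only: add_2_eq_Suc')
  qed
  then have "(\<Sum>j = 2..m + 2. b j * conv_power (\<lambda>n. if n \<le> Suc m then rho_seq b n else 0) j (m + 2)) =
        (\<Sum>j = 2..m + 2. b j * conv_power (rho_seq b) j (m + 2))"
    by (intro sum.cong[OF refl] arg_cong[where f = "(*) (b _)"])
  moreover have "k + 1 = m + 2" "k + 1 = Suc (Suc m)" using k by simp_all
  ultimately show ?thesis by (simp only: rho_seq.simps(3)[of b m] add_2_eq_Suc')
qed

end

theory Submission
  imports Defs
begin

text \<open>
  Write \<open>p\<^sub>j = - b\<^sub>j / b\<^sub>1\<close> for \<open>j \<noteq> 1\<close>.  Whatever the weights \<open>w\<close>, the jump chain moves from \<open>i \<ge> 1\<close> to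
  \<open>i + j - 1\<close> with probability \<open>p\<^sub>j\<close>.  The law of the jump chain is obtained without the strong
  Markov property: the successive distinct values of the skeleton \<open>X (m h)\<close> follow a given finite
  list of states with probability \<open>\<Prod> P\<^sub>h(i, j) / (1 - P\<^sub>h(i, i))\<close>, and by right continuity the skeleton
  follows the list for all small \<open>h\<close> if and only if the path does.

  As all downward jumps have size one, only finitely many lists lead from \<open>i\<close> to \<open>0\<close> with
  exactly \<open>k\<close> deaths.  Conditioning on the first jump shows that their total probability satisfies
  the recursion of the coefficient of \<open>v\<^sup>k\<close> in \<open>R(v)\<^sup>i\<close>, where \<open>R(v) = \<Sum> \<rho>\<^sub>k v\<^sup>k\<close> solves
  \<open>R = p\<^sub>0 v + \<Sum>\<^bsub>j\<ge>2\<^esub> p\<^sub>j R\<^sup>j\<close>.  So \<open>P(Y\<^sub>0(\<tau>) = k, \<tau> < \<infinity>) = \<rho>\<^sub>k\<close>, and summing over \<open>k\<close> gives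
  \<open>P(\<tau> < \<infinity>) = R(1)\<close>, the least root of \<open>B\<close>.
\<close>

unbundle no vec_syntax
unbundle fps_syntax

section \<open>The sequence \<open>\<rho>\<close> and the least root of \<open>B\<close>\<close>

text \<open>Both sides sum the same products over the lists of length \<open>j\<close> with sum
  \<open>n\<close>, so the recursion for \<rho> becomes algebra of formal power series.\<close>

lemma conv_power_eq_fps_power: "conv_power f j n = (Abs_fps f ^ j) $ n"
proof (cases j)
  case 0
  then have "{l. length l = j \<and> sum_list l = n} = (if n = 0 then {[]} else {})"
    by auto
  then show ?thesis using 0 by (simp add: conv_power_def)
next
  case (Suc m)
  then show ?thesis
    unfolding conv_power_def Suc fps_power_nth_Suc natpermute_def
    by (intro sum.cong) (auto simp: prod.list_conv_set_nth atLeastLessThanSuc_atLeastAtMost)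
qed

section \<open>The offspring law and the functional equation of the power series
  \<open>R\<close>\<close>

locale offspring =
  fixes b :: "nat \<Rightarrow> real"
  assumes b_nonneg: "j \<noteq> 1 \<Longrightarrow> b j \<ge> 0"
    and b_neg: "b 1 < 0"
    and b_sum: "(b has_sum (- b 1)) {j. j \<noteq> 1}"
begin

definition p :: "nat \<Rightarrow> real" where
  "p j = (if j = 1 then 0 else b j / (- b 1))"

definition R :: "real fps" where
  "R = Abs_fps (rho_seq b)"

lemma p_nonneg: "p j \<ge> 0"
  using b_nonneg[of j] b_neg by (auto simp: p_def intro: divide_nonneg_neg)

lemma p_1 [simp]: "p (Suc 0) = 0"
  by (simp add: p_def)

lemma p_sums: "p sums 1"
proof -
  have "((\<lambda>j. b j * inverse (- b 1)) has_sum (- b 1 * inverse (- b 1))) {j. j \<noteq> 1}"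
    by (rule has_sum_cmult_left[OF b_sum])
  then have "(p has_sum 1) UNIV"
    using b_neg by (subst has_sum_cong_neutral[where T = "{j. j \<noteq> 1}"])
      (auto simp: p_def field_simps)
  then show ?thesis by (rule has_sum_imp_sums)
qed

lemma p_power_summable:
  assumes "0 \<le> u" "u \<le> 1"
  shows "summable (\<lambda>j. p j * u ^ j)"
proof (rule summable_comparison_test_ev)
  show "\<forall>\<^sub>F j in sequentially. norm (p j * u ^ j) \<le> p j"
    using assms by (intro always_eventually allI) 
      (simp add: abs_mult p_nonneg mult_left_le power_le_one)
  show "summable p" using p_sums by (rule sums_summable)
qed

text \<open>Splitting off the linear term \<open>b 1 * u\<close> turns the roots of B in [0, 1] into
  the fixed points of the generating function of \<open>p\<close>.\<close>

lemma B_fun_eq: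
  assumes "0 \<le> u" "u \<le> 1"
  shows "B_fun b u = - b 1 * ((\<Sum>j. p j * u ^ j) - u)"
proof -
  have "(\<lambda>j. if j = 1 then b 1 * u else 0) sums (b 1 * u)"
    by (rule sums_single)
  moreover have "(\<lambda>j. - b 1 * (p j * u ^ j)) sums (- b 1 * (\<Sum>j. p j * u ^ j))"
    by (intro sums_mult summable_sums p_power_summable assms)
  ultimately have "(\<lambda>j. - b 1 * (p j * u ^ j) + (if j = 1 then b 1 * u else 0)) sums
      (- b 1 * (\<Sum>j. p j * u ^ j) + b 1 * u)"
    by (intro sums_add)
  moreover have "(\<lambda>j. - b 1 * (p j * u ^ j) + (if j = 1 then b 1 * u else 0)) = (\<lambda>j. b j * u ^ j)"
    using b_neg by (auto simp: p_def fun_eq_iff)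
  ultimately show ?thesis
    by (auto simp: B_fun_def algebra_simps dest: sums_unique)
qed

lemma R_power_zero: "k < i \<Longrightarrow> (R ^ i) $ k = 0"
  using startsby_zero_power_prefix[of R i] by (simp add: R_def)

text \<open>The functional equation of \<open>R\<close> can be truncated: \<open>R ^ j\<close> has
  no coefficient below index \<open>j\<close>, so a finite sum up to any \<open>k \<ge> m\<close>
  determines coefficient \<open>m\<close>, and no infinite sum of power series has to be
  formed.\<close>

lemma R_rec:
  assumes "m \<le> k"
  shows "R $ m = (fps_const (p 0) * fps_X + (\<Sum>j = 2..k. fps_const (p j) * R ^ j)) $ m"
proof -
  have *: "(\<Sum>j = 2..k. p j * (R ^ j) $ m) = (\<Sum>j = 2..m. p j * (R ^ j) $ m)"
    using assms by (intro sum.mono_neutral_right) (auto simp: R_power_zero)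
  consider "m = 0" | "m = 1" | n where "m = n + 1" "n \<ge> 1"
    by (cases m) (auto simp: Suc_eq_plus1 simp flip: One_nat_def, force)
  then show ?thesis
  proof cases
    case 3
    have "R $ m = - inverse (b 1) * (\<Sum>j = 2..m. b j * (R ^ j) $ m)"
      using rho_seq_rec[OF 3(2), of b] 3(1) by (simp add: R_def conv_power_eq_fps_power)
    also have "\<dots> = (\<Sum>j = 2..m. p j * (R ^ j) $ m)"
      unfolding sum_distrib_left by (rule sum.cong) (auto simp: p_def field_simps)
    finally show ?thesis using 3 * by (simp add: fps_sum_nth fps_X_def)
  qed (use * in \<open>simp_all add: fps_sum_nth R_def p_def field_simps\<close>)
qed

text \<open>Multiplied by \<open>R ^ i\<close>, the truncated equation becomes a decomposition at
  the first jump. One bound \<open>K\<close> serves all coefficients \<open>k \<le> K\<close>, which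
  allows summation over \<open>k\<close>.\<close>

lemma R_power_rec:
  assumes "k \<le> K"
  shows "(R ^ Suc i) $ k = (if k = 0 then 0 else p 0 * (R ^ i) $ (k - 1))
    + (\<Sum>j = 2..K. p j * (R ^ (i + j)) $ k)"
proof -
  define Q where "Q = fps_const (p 0) * fps_X + (\<Sum>j = 2..K. fps_const (p j) * R ^ j)"
  have "(R ^ Suc i) $ k = (Q * R ^ i) $ k"
    using assms by (auto simp: fps_mult_nth Q_def R_rec[of _ K] intro!: sum.cong)
  also have "Q * R ^ i = fps_const (p 0) * (fps_X * R ^ i)
      + (\<Sum>j = 2..K. fps_const (p j) * R ^ (i + j))"
    by (simp add: Q_def ring_distribs sum_distrib_left sum_distrib_right power_add mult_ac)
  finally show ?thesis by (simp add: fps_sum_nth)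
qed

text \<open>
  A death lowers both \<open>i\<close> and \<open>k\<close> by one and a birth raises \<open>i\<close>, so \<open>2 * k - i\<close> decreases along the
  recursion; for \<open>i > k\<close> the coefficients vanish.
\<close>

lemma R_power_nonneg: "(R ^ i) $ k \<ge> 0"
proof (induction "2 * k - i" arbitrary: i k rule: less_induct)
  case less
  show ?case
  proof (cases "i = 0 \<or> k < i")
    case True
    then show ?thesis by (auto simp: R_power_zero)
  next
    case False
    then obtain n where n: "i = Suc n" "n < k" by (cases i) auto
    have "(R ^ n) $ (k - 1) \<ge> 0" using n by (intro less) auto
    moreover have "(R ^ (n + j)) $ k \<ge> 0" if "j \<ge> 2" for j
      using n that by (intro less) auto
    ultimately show ?thesis
      unfolding n(1) R_power_rec[OF order_refl] using n
      by (auto intro!: add_nonneg_nonneg sum_nonneg mult_nonneg_nonneg p_nonneg)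
  qed
qed

lemma rho_nonneg: "rho_seq b k \<ge> 0"
  using R_power_nonneg[of 1 k] by (simp add: R_def)

section \<open>The sum of the coefficients as the least fixed point\<close>

text \<open>By induction the recursion bounds the sum for \<open>i = Suc n\<close> by
  \<open>s ^ n\<close> times a partial sum of the generating function at \<open>s\<close>, whose
  full value is \<open>s\<close> again.\<close>

lemma sum_R_power_le_root:
  assumes s: "0 \<le> s" "s \<le> 1" "(\<Sum>j. p j * s ^ j) = s"
  shows "(\<Sum>k\<le>K. (R ^ i) $ k) \<le> s ^ i"
proof (induction "2 * K - i" arbitrary: i K rule: less_induct)
  case less
  consider "K < i" | "i = 0" | "0 < i" "i \<le> K" by linarith
  then show ?case
  proof cases
    case 1
    then show ?thesis using s by (simp add: R_power_zero)
  next
    case 2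
    then show ?thesis by (simp add: sum.delta)
  next
    case le: 3
    then obtain n where "i = Suc n" by (cases i) auto
    moreover from le obtain L where "K = Suc L" by (cases K) auto
    ultimately have 3: "i = Suc n" "n < K" "K = Suc L" using le by auto
    have "(\<Sum>k\<le>K. (R ^ i) $ k) = (\<Sum>k\<le>K. if k = 0 then 0 else p 0 * (R ^ n) $ (k - 1))
        + (\<Sum>k\<le>K. \<Sum>j = 2..K. p j * (R ^ (n + j)) $ k)"
      unfolding 3(1) sum.distrib[symmetric] by (rule sum.cong[OF refl]) (simp add: R_power_rec[of _ K n] del: power_Suc)
    \<comment> \<open>The summand at \<open>k = 0\<close> is 0, so the shift to \<open>k - 1\<close>
      leaves the partial sum up to \<open>L = K - 1\<close>.\<close>
    also have "(\<Sum>k\<le>K. if k = 0 then 0 else p 0 * (R ^ n) $ (k - 1)) = p 0 * (\<Sum>k\<le>L. (R ^ n) $ k)"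
      unfolding 3(3) by (subst sum.atMost_Suc_shift) (simp add: sum_distrib_left)
    also have "(\<Sum>k\<le>K. \<Sum>j = 2..K. p j * (R ^ (n + j)) $ k)
        = (\<Sum>j = 2..K. p j * (\<Sum>k\<le>K. (R ^ (n + j)) $ k))"
      by (subst sum.swap) (simp add: sum_distrib_left)
    also have "p 0 * (\<Sum>k\<le>L. (R ^ n) $ k) + \<dots> \<le> p 0 * s ^ n + (\<Sum>j = 2..K. p j * s ^ (n + j))"
      using 3 by (intro add_mono sum_mono mult_left_mono p_nonneg less) auto
    also have "\<dots> = s ^ n * (\<Sum>j\<in>insert 0 {2..K}. p j * s ^ j)"
      by (simp add: sum_distrib_left power_add algebra_simps)
    also have "\<dots> \<le> s ^ n * (\<Sum>j. p j * s ^ j)"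
      using s by (intro mult_left_mono sum_le_suminf p_power_summable) (auto simp: p_nonneg)
    finally show ?thesis unfolding s(3) by (simp add: 3(1) mult.commute)
  qed
qed

text \<open>The value 1 is a fixed point because \<open>p\<close> has total mass 1, and it bounds
  all partial sums.\<close>

lemma rho_summable: "summable (rho_seq b)"
proof (rule bounded_imp_summable)
  show "rho_seq b k \<ge> 0" for k by (rule rho_nonneg)
  have "(\<Sum>j. p j * 1 ^ j) = 1" using p_sums by (simp add: sums_unique[symmetric])
  from sum_R_power_le_root[OF _ _ this, where i = 1]
  show "(\<Sum>k\<le>n. rho_seq b k) \<le> 1" for n by (simp add: R_def)
qed

text \<open>By Cauchy products of series with nonnegative terms, the sum of all coefficients is
  multiplicative on powers of \<open>R\<close>.\<close>

lemma R_power_sums: "(\<lambda>k. (R ^ i) $ k) sums (\<Sum>k. rho_seq b k) ^ i"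
proof (induction i)
  case 0
  then show ?case using sums_single[of 0 "\<lambda>_. 1 :: real"] by (simp add: eq_commute)
next
  case (Suc i)
  have "(\<lambda>k. \<Sum>m\<le>k. rho_seq b m * (R ^ i) $ (k - m)) sums
      ((\<Sum>k. rho_seq b k) * (\<Sum>k. (R ^ i) $ k))"
    using rho_summable sums_summable[OF Suc]
    by (intro Cauchy_product_sums) (simp_all add: rho_nonneg R_power_nonneg)
  then show ?case
    using Suc by (simp add: sums_unique[symmetric] fps_mult_nth R_def atLeast0AtMost)
qed

lemma sum_R_eq:
  assumes "K \<le> J"
  shows "(\<Sum>k\<le>K. R $ k) = (if K = 0 then 0 else p 0) + (\<Sum>j = 2..J. p j * (\<Sum>k\<le>K. (R ^ j) $ k))"
proof -
  have "(\<Sum>k\<le>K. R $ k) = (\<Sum>k\<le>K. (if k = 1 then p 0 else 0) + (\<Sum>j = 2..J. p j * (R ^ j) $ k))"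
    using assms by (intro sum.cong refl) (simp add: R_rec[of _ J] fps_sum_nth fps_X_def)
  also have "\<dots> = (\<Sum>k\<le>K. if k = 1 then p 0 else 0) + (\<Sum>k\<le>K. \<Sum>j = 2..J. p j * (R ^ j) $ k)"
    by (rule sum.distrib)
  also have "(\<Sum>k\<le>K. if k = 1 then p 0 else 0) = (if K = 0 then 0 else p 0)"
    by (simp add: sum.delta')
  also have "(\<Sum>k\<le>K. \<Sum>j = 2..J. p j * (R ^ j) $ k) = (\<Sum>j = 2..J. \<Sum>k\<le>K. p j * (R ^ j) $ k)"
    by (rule sum.swap)
  finally show ?thesis by (simp only: sum_distrib_left)
qed

lemma rho_sum_le_root:
  assumes "0 \<le> s" "s \<le> 1" "(\<Sum>j. p j * s ^ j) = s"
  shows "(\<Sum>k. rho_seq b k) \<le> s"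
proof (rule LIMSEQ_le_const2)
  show "(\<lambda>K. \<Sum>k\<le>K. rho_seq b k) \<longlonglongrightarrow> (\<Sum>k. rho_seq b k)"
    by (rule summable_LIMSEQ'[OF rho_summable])
  show "\<exists>N. \<forall>K\<ge>N. (\<Sum>k\<le>K. rho_seq b k) \<le> s"
    using sum_R_power_le_root[OF assms, where i = 1] by (simp add: R_def)
qed

lemma rho_sum_bounds: "0 \<le> (\<Sum>k. rho_seq b k)" "(\<Sum>k. rho_seq b k) \<le> 1"
proof -
  have "(\<Sum>j. p j * 1 ^ j) = 1" using p_sums by (simp add: sums_unique[symmetric])
  then show "(\<Sum>k. rho_seq b k) \<le> 1" by (intro rho_sum_le_root) auto
  show "0 \<le> (\<Sum>k. rho_seq b k)" by (intro suminf_nonneg rho_summable rho_nonneg)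
qed

text \<open>Each inequality comes from finite truncations in \<open>j\<close> and in
  \<open>k\<close>; as all terms are nonnegative, every truncation is a lower bound of the full
  sum.\<close>

lemma rho_sum_fixed_point:
  defines "u \<equiv> \<Sum>k. rho_seq b k"
  shows "(\<Sum>j. p j * u ^ j) = u"
proof (rule antisym)
  have u: "0 \<le> u" "u \<le> 1" using rho_sum_bounds by (simp_all add: u_def)
  have R_sums: "(\<lambda>k. R $ k) sums u"
    using rho_summable by (simp add: u_def R_def summable_sums)
  \<comment> \<open>The term with index 1 drops out because \<open>p 1 = 0\<close>.\<close>
  have split: "(\<Sum>j\<le>Suc J. p j * f j) = p 0 * f 0 + (\<Sum>j = 2..Suc J. p j * f j)" for f :: "nat \<Rightarrow> real" and J
  proof -
    have "{..Suc J} = insert 0 (insert 1 {2..Suc J})" by auto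
    then show ?thesis by simp
  qed
  show "(\<Sum>j. p j * u ^ j) \<le> u"
  proof (rule LIMSEQ_le_const2)
    show "(\<lambda>J. \<Sum>j\<le>Suc J. p j * u ^ j) \<longlonglongrightarrow> (\<Sum>j. p j * u ^ j)"
      by (rule LIMSEQ_Suc[OF summable_LIMSEQ'[OF p_power_summable[OF u]]])
    \<comment> \<open>For fixed \<open>J\<close> only finitely many powers of \<open>R\<close>
      occur, so \<open>K\<close> can tend to infinity in each of them; for
      \<open>K \<ge> Suc J\<close> the sum is dominated by a partial sum of
      \<open>R\<close>.\<close>
    have "(\<Sum>j\<le>Suc J. p j * u ^ j) \<le> u" for J
    proof (rule LIMSEQ_le_const2)
      show "(\<lambda>K. p 0 + (\<Sum>j = 2..Suc J. p j * (\<Sum>k\<le>K. (R ^ j) $ k)))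
          \<longlonglongrightarrow> (\<Sum>j\<le>Suc J. p j * u ^ j)"
        unfolding split using R_power_sums unfolding sums_def_le u_def
        by (simp only: power_0 mult_1_right) (intro tendsto_intros, auto)
      show "\<exists>N. \<forall>K\<ge>N. p 0 + (\<Sum>j = 2..Suc J. p j * (\<Sum>k\<le>K. (R ^ j) $ k)) \<le> u"
      proof (intro exI allI impI)
        fix K assume K: "K \<ge> Suc J"
        have "p 0 + (\<Sum>j = 2..Suc J. p j * (\<Sum>k\<le>K. (R ^ j) $ k)) \<le>
            p 0 + (\<Sum>j = 2..K. p j * (\<Sum>k\<le>K. (R ^ j) $ k))"
          using K by (intro add_left_mono sum_mono2)
            (auto intro!: mult_nonneg_nonneg sum_nonneg p_nonneg R_power_nonneg)
        also have "\<dots> = (\<Sum>k\<le>K. R $ k)"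
          using K by (simp add: sum_R_eq[OF order_refl])
        also have "\<dots> \<le> u"
          using sum_le_suminf[of "($) R" "{..K}"] R_sums R_power_nonneg[of 1]
          by (simp add: sums_iff)
        finally show "p 0 + (\<Sum>j = 2..Suc J. p j * (\<Sum>k\<le>K. (R ^ j) $ k)) \<le> u" .
      qed
    qed
    then show "\<exists>N. \<forall>J\<ge>N. (\<Sum>j\<le>Suc J. p j * u ^ j) \<le> (u::real)" by blast
  qed
  show "u \<le> (\<Sum>j. p j * u ^ j)"
  proof (rule LIMSEQ_le_const2)
    show "(\<lambda>K. \<Sum>k\<le>Suc K. R $ k) \<longlonglongrightarrow> u"
      using LIMSEQ_Suc[of "\<lambda>K. \<Sum>k\<le>K. R $ k"] R_sums unfolding sums_def_le by blast
    have "(\<Sum>k\<le>Suc K. R $ k) \<le> (\<Sum>j. p j * u ^ j)" for K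
    proof -
      have "(\<Sum>k\<le>Suc K. (R ^ j) $ k) \<le> u ^ j" for j
        using sum_le_suminf[of "($) (R ^ j)" "{..Suc K}"] R_power_sums[of j]
        by (simp add: sums_iff R_power_nonneg u_def)
      then have "(\<Sum>k\<le>Suc K. R $ k) \<le> p 0 + (\<Sum>j = 2..Suc K. p j * u ^ j)"
        unfolding sum_R_eq[OF order_refl]
        by (intro add_mono sum_mono mult_left_mono p_nonneg) auto
      also have "\<dots> = (\<Sum>j\<le>Suc K. p j * u ^ j)"
        by (simp only: split power_0 mult_1_right)
      also have "\<dots> \<le> (\<Sum>j. p j * u ^ j)"
        using u by (intro sum_le_suminf p_power_summable) (auto simp: p_nonneg)
      finally show ?thesis .
    qed
    then show "\<exists>N. \<forall>K\<ge>N. (\<Sum>k\<le>Suc K. R $ k) \<le> (\<Sum>j. p j * u ^ j)" by blast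
  qed
qed

text \<open>The sum of the \<rho>'s is itself a root and lies below every root in [0, 1], so
  \<open>LEAST\<close> is attained there.\<close>

lemma min_root_eq: "min_root b = (\<Sum>k. rho_seq b k)"
proof -
  have root_iff: "B_fun b s = 0 \<longleftrightarrow> (\<Sum>j. p j * s ^ j) = s" if "0 \<le> s" "s \<le> 1" for s
    unfolding B_fun_eq[OF that] using b_neg by simp
  show ?thesis
    unfolding min_root_def
    using rho_sum_bounds rho_sum_fixed_point rho_sum_le_root
    by (intro Least_equality) (auto simp: root_iff)
qed

end

section \<open>Paths and their skeletons\<close>

definition right_constant :: "(real \<Rightarrow> 'b) \<Rightarrow> bool" where
  "right_constant f \<longleftrightarrow> (\<forall>t\<ge>0. \<forall>\<^sub>F s in at_right t. f s = f t)"

lemma right_constantE: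
  assumes "right_constant f" "0 \<le> t"
  obtains e where "0 < e" "\<And>s. t \<le> s \<Longrightarrow> s < t + e \<Longrightarrow> f s = f t"
proof -
  have "\<forall>\<^sub>F s in at_right t. f s = f t" using assms by (simp add: right_constant_def)
  then obtain u where u: "t < u" "\<And>s. t < s \<Longrightarrow> s < u \<Longrightarrow> f s = f t"
    by (auto simp: eventually_at_right_field)
  have "f s = f t" if "t \<le> s" "s < t + (u - t)" for s
    using u(2)[of s] that by (cases "s = t") auto
  with u(1) show thesis by (metis that diff_gt_0_iff_gt)
qed

lemma eventually_at_right_shift:
  "eventually P (at_right (s + t)) \<longleftrightarrow> eventually (\<lambda>r. P (s + r)) (at_right (t :: real))"
proof -
  have "at_right (s + t) = filtermap (\<lambda>x. x + s) (at_right t)"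
    using filtermap_nhds_shift[of "- s" t]
    by (subst at_right_to_0, subst (2) at_right_to_0) (simp add: filtermap_filtermap add_ac)
  then show ?thesis by (simp add: eventually_filtermap add.commute)
qed

lemma eventually_at_left_shift:
  "eventually P (at_left (s + t)) \<longleftrightarrow> eventually (\<lambda>r. P (s + r)) (at_left (t :: real))"
  unfolding eventually_at_left_to_right minus_add_distrib eventually_at_right_shift
  by (simp add: algebra_simps)

lemma right_constant_shift:
  assumes "right_constant f" "0 \<le> s"
  shows "right_constant (\<lambda>r. f (s + r))"
  using assms unfolding right_constant_def
  by (auto simp flip: eventually_at_right_shift[where P = "\<lambda>x. f x = _"])

text \<open>The witness is the infimum of the times with \<open>f r \<noteq> f 0\<close>. If
  \<open>f\<close> still had its initial value there, right constancy would push the infimum further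
  right; so the exit is attained, and hence positive.\<close>

lemma first_exit:
  assumes f: "right_constant f" and t: "0 \<le> t" "f t \<noteq> f 0"
  obtains s where "0 < s" "s \<le> t" "\<And>r. 0 \<le> r \<Longrightarrow> r < s \<Longrightarrow> f r = f 0" "f s \<noteq> f 0"
proof -
  define A where "A = {r. 0 \<le> r \<and> f r \<noteq> f 0}"
  have bdd: "bdd_below A" by (auto simp: A_def bdd_below_def)
  have tA: "t \<in> A" using t by (simp add: A_def)
  have s0: "0 \<le> Inf A" using tA by (intro cInf_greatest) (auto simp: A_def)
  have before: "f r = f 0" if "0 \<le> r" "r < Inf A" for r
    using cInf_lower[OF _ bdd, of r] that by (auto simp: A_def)
  have "f (Inf A) \<noteq> f 0"
  proof
    assume eq: "f (Inf A) = f 0"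
    obtain e where e: "0 < e" "\<And>s. Inf A \<le> s \<Longrightarrow> s < Inf A + e \<Longrightarrow> f s = f (Inf A)"
      using right_constantE[OF f s0] by blast
    have "Inf A + e \<le> Inf A"
    proof (rule cInf_greatest)
      fix r assume r: "r \<in> A"
      then have "Inf A \<le> r" by (intro cInf_lower bdd)
      then show "Inf A + e \<le> r" using e(2)[of r] eq r by (force simp: A_def)
    qed (use tA in auto)
    then show False using e by simp
  qed
  moreover from this have "0 < Inf A" using s0 by (cases "Inf A = 0") auto
  moreover have "Inf A \<le> t" using tA bdd by (rule cInf_lower)
  ultimately show thesis using before that by blast
qed

section \<open>Following a list of states in continuous time and along a grid\<close>

text \<open>Nothing is required after the entry into the last state. For a list with distinct
  neighbours and a right-continuous step function this says that the jump chain begins with the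
  list.\<close>

fun follows :: "'b list \<Rightarrow> (real \<Rightarrow> 'b) \<Rightarrow> bool" where
  "follows [] f \<longleftrightarrow> False"
| "follows [i] f \<longleftrightarrow> f 0 = i"
| "follows (i # j # l) f \<longleftrightarrow>
     (\<exists>s>0. (\<forall>r. 0 \<le> r \<longrightarrow> r < s \<longrightarrow> f r = i) \<and> follows (j # l) (\<lambda>r. f (s + r)))"

fun visits :: "'b list \<Rightarrow> (nat \<Rightarrow> 'b) \<Rightarrow> bool" where
  "visits [] x \<longleftrightarrow> False"
| "visits [i] x \<longleftrightarrow> x 0 = i"
| "visits (i # j # l) x \<longleftrightarrow>
     (\<exists>d. (\<forall>m\<le>d. x m = i) \<and> visits (j # l) (\<lambda>m. x (m + Suc d)))"

lemma follows_start: "follows (i # l) f \<Longrightarrow> f 0 = i"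
  by (cases l) auto

lemma visits_start: "visits (i # l) x \<Longrightarrow> x 0 = i"
  by (cases l) auto

text \<open>For \<open>i \<noteq> j\<close> the time quantified in \<open>follows\<close> can only
  be the first exit time, which removes the existential quantifier.\<close>

lemma follows_exit:
  assumes s: "0 < s" "\<And>r. 0 \<le> r \<Longrightarrow> r < s \<Longrightarrow> f r = f 0" "f s \<noteq> f 0" and "i \<noteq> j"
  shows "follows (i # j # l) f \<longleftrightarrow> f 0 = i \<and> follows (j # l) (\<lambda>r. f (s + r))"
proof
  assume "follows (i # j # l) f"
  then obtain u where u: "u > 0" "\<And>r. 0 \<le> r \<Longrightarrow> r < u \<Longrightarrow> f r = i" "follows (j # l) (\<lambda>r. f (u + r))"
    unfolding follows.simps(3) by blast
  have "f u = j" using follows_start[OF u(3)] by simp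
  moreover have f0: "f 0 = i" using u by simp
  ultimately have "u = s" using s u \<open>i \<noteq> j\<close>
    by (metis less_eq_real_def linorder_neqE_linordered_idom)
  then show "f 0 = i \<and> follows (j # l) (\<lambda>r. f (s + r))" using u f0 by simp
next
  assume "f 0 = i \<and> follows (j # l) (\<lambda>r. f (s + r))"
  then show "follows (i # j # l) f" unfolding follows.simps(3) using s by metis
qed

lemma visits_exit:
  assumes d: "\<And>m. m \<le> d \<Longrightarrow> x m = x 0" "x (Suc d) \<noteq> x 0" and "i \<noteq> j"
  shows "visits (i # j # l) x \<longleftrightarrow> x 0 = i \<and> visits (j # l) (\<lambda>m. x (m + Suc d))"
proof
  assume "visits (i # j # l) x"
  then obtain u where u: "\<And>m. m \<le> u \<Longrightarrow> x m = i" "visits (j # l) (\<lambda>m. x (m + Suc u))"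
    unfolding visits.simps(3) by blast
  have "x (Suc u) = j" using visits_start[OF u(2)] by simp
  moreover have x0: "x 0 = i" using u by simp
  ultimately have "u = d" using d u \<open>i \<noteq> j\<close>
    by (metis Suc_leI linorder_neqE_nat)
  then show "x 0 = i \<and> visits (j # l) (\<lambda>m. x (m + Suc d))" using u x0 by simp
next
  assume "x 0 = i \<and> visits (j # l) (\<lambda>m. x (m + Suc d))"
  then show "visits (i # j # l) x" unfolding visits.simps(3) using d by metis
qed

text \<open>The grid starts at an offset \<open>a\<close> because jump times need not lie on the grid.\<close>

lemma visits_skeleton:
  assumes "right_constant f" "successively (\<noteq>) l"
  shows "\<exists>\<delta>>0. \<forall>h a. 0 < h \<longrightarrow> h < \<delta> \<longrightarrow> 0 \<le> a \<longrightarrow> a < h \<longrightarrow>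
    visits l (\<lambda>m. f (a + real m * h)) = follows l f"
  using assms
proof (induction l arbitrary: f rule: induct_list012)
  case 1
  show ?case by (intro exI[of _ 1]) simp
next
  case (2 i)
  obtain e where e: "0 < e" "\<And>s. 0 \<le> s \<Longrightarrow> s < 0 + e \<Longrightarrow> f s = f 0"
    using right_constantE[OF 2(1)] by blast
  show ?case
  proof (intro exI[of _ e] conjI allI impI)
    fix h a :: real assume "0 \<le> a" "a < h" "h < e"
    then show "visits [i] (\<lambda>m. f (a + real m * h)) = follows [i] f" using e(2)[of a] by simp
  qed (rule e(1))
next
  case (3 i j l)
  have ij: "i \<noteq> j" and l: "successively (\<noteq>) (j # l)" using 3 by auto
  show ?case
  proof (cases "\<exists>t\<ge>0. f t \<noteq> f 0")
    \<comment> \<open>A path that never leaves its first state neither follows nor visits two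
      distinct states.\<close>
    case False
    then have const: "f t = f 0" if "0 \<le> t" for t using that by blast
    have "\<not> follows (i # j # l) f"
    proof
      assume "follows (i # j # l) f"
      then obtain u where "u > 0" "f 0 = i" "follows (j # l) (\<lambda>r. f (u + r))"
        unfolding follows.simps(3) by blast
      then show False using const[of u] ij follows_start[of j l "\<lambda>r. f (u + r)"] by simp
    qed
    moreover have "\<not> visits (i # j # l) (\<lambda>m. f (a + real m * h))" if "0 < h" "0 \<le> a" for a h
    proof
      assume "visits (i # j # l) (\<lambda>m. f (a + real m * h))"
      then obtain d where d: "f (a + real 0 * h) = i"
          "visits (j # l) (\<lambda>m. f (a + real (m + Suc d) * h))"
        unfolding visits.simps(3) by blast
      then have "f (a + real (0 + Suc d) * h) = j" using visits_start by fast
      moreover have "f (a + real n * h) = f 0" for n using that by (intro const) auto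
      ultimately show False using d(1) ij by metis
    qed
    ultimately show ?thesis by (metis zero_less_one)
  next
    case True
    then obtain s where s: "0 < s" "\<And>r. 0 \<le> r \<Longrightarrow> r < s \<Longrightarrow> f r = f 0" "f s \<noteq> f 0"
      using first_exit[OF 3(3)] by blast
    obtain e where e: "0 < e" "\<And>r. s \<le> r \<Longrightarrow> r < s + e \<Longrightarrow> f r = f s"
      using right_constantE[OF 3(3)] s(1) less_imp_le by blast
    define g where "g = (\<lambda>r. f (s + r))"
    have "right_constant g" unfolding g_def using 3(3) s(1) by (intro right_constant_shift) auto
    then have "\<exists>\<delta>>0. \<forall>h a. 0 < h \<longrightarrow> h < \<delta> \<longrightarrow> 0 \<le> a \<longrightarrow> a < h \<longrightarrow>
        visits (j # l) (\<lambda>m. g (a + real m * h)) = follows (j # l) g"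
      using l by (rule "3.IH"(2))
    then obtain \<delta> where \<delta>: "\<delta> > 0"
      "\<And>h a. 0 < h \<Longrightarrow> h < \<delta> \<Longrightarrow> 0 \<le> a \<Longrightarrow> a < h \<Longrightarrow>
        visits (j # l) (\<lambda>m. g (a + real m * h)) = follows (j # l) g"
      by blast
    show ?thesis
    \<comment> \<open>Mesh below \<open>s\<close> puts the first grid point before the exit, mesh
      below \<open>e\<close> makes the grid see the state entered at \<open>s\<close>, and mesh
      below \<open>\<delta>\<close> serves the restarted path.\<close>
    proof (rule exI[of _ "min \<delta> (min s e)"], intro conjI allI impI)
      show "min \<delta> (min s e) > 0" using \<delta>(1) s(1) e(1) by simp
      fix h a :: real
      assume h: "0 < h" "h < min \<delta> (min s e)" and a: "0 \<le> a" "a < h"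
      \<comment> \<open>The ceiling makes \<open>d\<close> the index of the last grid point strictly
        before the exit time \<open>s\<close>.\<close>
      define d where "d = nat \<lceil>(s - a) / h\<rceil> - 1"
      have "(s - a) / h > 0" using h a by auto
      then have "real (Suc d) = of_int \<lceil>(s - a) / h\<rceil>" unfolding d_def by linarith
      then have "real d < (s - a) / h" "(s - a) / h \<le> real (Suc d)" by linarith+
      then have d: "a + real d * h < s" "s \<le> a + real (Suc d) * h"
        using h by (simp_all add: field_simps)
      \<comment> \<open>The overshoot of the next grid point beyond \<open>s\<close> is the offset
        of the grid for the restarted path.\<close>
      define a' where "a' = a + real (Suc d) * h - s"
      have a': "0 \<le> a'" "a' < h" using d by (simp_all add: a'_def algebra_simps)
      define x where "x = (\<lambda>m. f (a + real m * h))"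
      have x: "x m = f 0" if "m \<le> d" for m
      proof -
        have "real m * h \<le> real d * h" using that h by (intro mult_right_mono) auto
        then have "a + real m * h < s" using d(1) by linarith
        then show ?thesis unfolding x_def using a h by (intro s(2)) auto
      qed
      have "x (Suc d) = f s" unfolding x_def using d a' h by (intro e(2)) (auto simp: a'_def)
      then have x': "x (Suc d) \<noteq> x 0" using s(3) x[of 0] by simp
      have "(\<lambda>m. x (m + Suc d)) = (\<lambda>m. g (a' + real m * h))"
        unfolding x_def g_def by (rule ext, rule arg_cong[where f = f]) (simp add: a'_def algebra_simps)
      then have "visits (i # j # l) x \<longleftrightarrow> x 0 = i \<and> visits (j # l) (\<lambda>m. g (a' + real m * h))"
        using visits_exit[OF _ x' ij, of l] x by simp
      also have "\<dots> \<longleftrightarrow> f 0 = i \<and> follows (j # l) g"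
        using \<delta>(2)[of h a'] a' h x[of 0] by simp
      also have "\<dots> \<longleftrightarrow> follows (i # j # l) f"
        unfolding g_def by (rule follows_exit[OF s ij, symmetric])
      finally show "visits (i # j # l) (\<lambda>m. f (a + real m * h)) = follows (i # j # l) f"
        by (simp only: x_def)
    qed
  qed
qed

section \<open>The law of the states visited along a grid\<close>

fun path_weight :: "('b \<Rightarrow> 'b \<Rightarrow> real) \<Rightarrow> 'b list \<Rightarrow> real" where
  "path_weight p (i # j # l) = p i j * path_weight p (j # l)"
| "path_weight p _ = 1"

lemma measurable_visits:
  fixes Y :: "nat \<Rightarrow> 'a \<Rightarrow> nat"
  assumes "\<And>m. Y m \<in> M \<rightarrow>\<^sub>M count_space UNIV"
  shows "Measurable.pred M (\<lambda>\<omega>. visits l (\<lambda>m. Y m \<omega>))"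
  using assms
proof (induction l arbitrary: Y rule: induct_list012)
  case (2 i)
  note [measurable] = 2
  show ?case by simp
next
  case (3 i j l)
  note [measurable] = 3(3)
  have [measurable]: "Measurable.pred M (\<lambda>\<omega>. visits (j # l) (\<lambda>m. Y (m + Suc d) \<omega>))" for d
    by (rule 3(2)) (rule 3(3))
  show ?case unfolding visits.simps by measurable
qed simp

text \<open>Splitting by the length of the sojourn in the first state gives a geometric series with
  sum \<open>1 / (1 - P i i)\<close>. The prescribed prefix \<open>a\<close> makes the induction
  work, as \<open>markov\<close> speaks of cylinders that start at time 0.\<close>

lemma (in prob_space) prob_visits:
  fixes Y :: "nat \<Rightarrow> 'a \<Rightarrow> nat"
  assumes Y: "\<And>m. Y m \<in> M \<rightarrow>\<^sub>M count_space UNIV"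
    and markov: "\<And>n a. \<P>(\<omega> in M. \<forall>m\<le>Suc n. Y m \<omega> = a m) =
      \<P>(\<omega> in M. \<forall>m\<le>n. Y m \<omega> = a m) * P (a n) (a (Suc n))"
    and "successively (\<noteq>) l" "l \<noteq> []" "\<And>i. i \<in> set (butlast l) \<Longrightarrow> 0 \<le> P i i \<and> P i i < 1"
      "a K = hd l"
  shows "\<P>(\<omega> in M. (\<forall>m\<le>K. Y m \<omega> = a m) \<and> visits l (\<lambda>m. Y (m + K) \<omega>)) =
    \<P>(\<omega> in M. \<forall>m\<le>K. Y m \<omega> = a m) * path_weight (\<lambda>i j. P i j / (1 - P i i)) l"
  using assms(3-)
proof (induction l arbitrary: K a rule: induct_list012)
  case (2 i)
  then have "{\<omega> \<in> space M. (\<forall>m\<le>K. Y m \<omega> = a m) \<and> visits [i] (\<lambda>m. Y (m + K) \<omega>)} =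
      {\<omega> \<in> space M. \<forall>m\<le>K. Y m \<omega> = a m}"
    by auto
  then show ?case by simp
next
  case (3 i j l)
  note [measurable] = Y
  let ?p = "\<lambda>i j. P i j / (1 - P i i)"
  \<comment> \<open>The prefix is extended by \<open>d\<close> further steps in \<open>i\<close> and
    then one in \<open>j\<close>, so the sojourn in \<open>i = a K\<close> ends at step
    \<open>K + Suc d\<close>.\<close>
  define a' where "a' d m = (if m \<le> K then a m else if m \<le> K + d then i else j)" for d m
  define c where "c = \<P>(\<omega> in M. \<forall>m\<le>K. Y m \<omega> = a m)"
  define A where "A d = {\<omega> \<in> space M. (\<forall>m\<le>K + Suc d. Y m \<omega> = a' d m) \<and>
      visits (j # l) (\<lambda>m. Y (m + (K + Suc d)) \<omega>)}" for d
  have Pii: "0 \<le> P i i" "P i i < 1" and aK: "a K = i" using 3 by auto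
  have c: "e \<le> d \<Longrightarrow> \<P>(\<omega> in M. \<forall>m\<le>K + e. Y m \<omega> = a' d m) = c * P i i ^ e" for d e
  proof (induction e)
    case 0
    have "{\<omega> \<in> space M. \<forall>m\<le>K. Y m \<omega> = a' d m} = {\<omega> \<in> space M. \<forall>m\<le>K. Y m \<omega> = a m}"
      by (auto simp: a'_def)
    then show ?case by (simp add: c_def)
  next
    case (Suc e)
    have "a' d (K + e) = i" "a' d (Suc (K + e)) = i" using aK Suc by (auto simp: a'_def)
    then show ?case using Suc markov[of "K + e" "a' d"] by (simp del: all_simps)
  qed
  have prefix: "\<P>(\<omega> in M. \<forall>m\<le>K + Suc d. Y m \<omega> = a' d m) = c * P i i ^ d * P i j" for d
  proof -
    have "a' d (K + d) = i" "a' d (Suc (K + d)) = j" using aK by (auto simp: a'_def)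
    then show ?thesis using markov[of "K + d" "a' d"] c[of d d] by simp
  qed
  have "prob (A d) = c * P i i ^ d * P i j * path_weight ?p (j # l)" for d
    unfolding A_def prefix[symmetric] using 3 by (intro "3.IH"(2)) (auto simp: a'_def)
  moreover have "(\<lambda>d. prob (A d)) sums prob (\<Union>d. A d)"
  proof (rule finite_measure_UNION)
    have [measurable]: "Measurable.pred M (\<lambda>\<omega>. visits (j # l) (\<lambda>m. Y (m + (K + Suc d)) \<omega>))" for d
      by (rule measurable_visits) (rule Y)
    have "A d \<in> sets M" for d unfolding A_def by measurable
    then show "range A \<subseteq> sets M" by blast
    \<comment> \<open>For \<open>d < e\<close>, at time \<open>K + Suc d\<close> the state is
      \<open>j\<close> on \<open>A d\<close> but still \<open>i\<close> on
      \<open>A e\<close>.\<close>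
    show "disjoint_family A"
      unfolding disjoint_family_on_def
    proof (intro ballI impI)
      fix d e :: nat assume "d \<noteq> e"
      then show "A d \<inter> A e = {}"
      proof (induction d e rule: linorder_wlog)
        case (le d e)
        have "Y (K + Suc d) \<omega> = j" if "\<omega> \<in> A d" for \<omega>
          using that by (auto simp: A_def a'_def)
        moreover have "Y (K + Suc d) \<omega> = i" if "\<omega> \<in> A e" for \<omega>
          using that le by (auto simp: A_def a'_def)
        ultimately show ?case using 3 by force
      qed auto
    qed
  qed
  moreover have "(\<lambda>d. c * P i i ^ d * P i j * path_weight ?p (j # l)) sums
      (c * (1 / (1 - P i i)) * P i j * path_weight ?p (j # l))"
    using Pii by (intro sums_mult sums_mult2 geometric_sums) auto
  ultimately have "prob (\<Union>d. A d) = c * path_weight ?p (i # j # l)"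
    using sums_unique2 by fastforce
  moreover have "(\<Union>d. A d) = {\<omega> \<in> space M. (\<forall>m\<le>K. Y m \<omega> = a m) \<and>
      visits (i # j # l) (\<lambda>m. Y (m + K) \<omega>)}"
  proof -
    have *: "(\<forall>m\<le>K + Suc d. x m = a' d m) \<and> visits (j # l) (\<lambda>m. x (m + (K + Suc d))) \<longleftrightarrow>
        (\<forall>m\<le>K. x m = a m) \<and> (\<forall>m\<le>d. x (m + K) = i) \<and> visits (j # l) (\<lambda>m. x (m + Suc d + K))"
      for d and x :: "nat \<Rightarrow> nat"
    proof (intro iffI conjI allI impI; (elim conjE)?)
      fix m assume m: "m \<le> d" and x: "\<forall>m\<le>K + Suc d. x m = a' d m"
      show "x (m + K) = i" using x[rule_format, of "m + K"] m aK by (auto simp: a'_def)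
    next
      fix m assume m: "m \<le> K + Suc d" and x: "\<forall>m\<le>K. x m = a m" "\<forall>m\<le>d. x (m + K) = i"
        "visits (j # l) (\<lambda>m. x (m + Suc d + K))"
      have "x (K + Suc d) = j" using visits_start[OF x(3)] by (simp add: add_ac)
      moreover have "x m = i" if "K < m" "m \<le> K + d"
        using x(2)[rule_format, of "m - K"] that by simp
      ultimately show "x m = a' d m" using x(1) m
        by (cases "m = K + Suc d") (auto simp: a'_def)
    qed (auto simp: a'_def add_ac)
    have "\<omega> \<in> A d \<longleftrightarrow> \<omega> \<in> space M \<and> (\<forall>m\<le>K. Y m \<omega> = a m) \<and>
        (\<forall>m\<le>d. Y (m + K) \<omega> = i) \<and> visits (j # l) (\<lambda>m. Y (m + Suc d + K) \<omega>)" for d \<omega>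
      unfolding A_def mem_Collect_eq using *[of d "\<lambda>m. Y m \<omega>"] by (simp only:)
    then show ?thesis unfolding visits.simps(3) by blast
  qed
  ultimately show ?case by (simp add: c_def)
qed simp

section \<open>The law of the jump chain\<close>

lemma tendsto_path_weight:
  assumes "\<And>i j. i \<in> set (butlast l) \<Longrightarrow> i \<noteq> j \<Longrightarrow> ((\<lambda>n. p n i j) \<longlongrightarrow> p' i j) F" "successively (\<noteq>) l"
  shows "((\<lambda>n. path_weight (p n) l) \<longlongrightarrow> path_weight p' l) F"
  using assms
proof (induction l rule: induct_list012)
  case (3 i j l)
  have "((\<lambda>n. p n i j) \<longlongrightarrow> p' i j) F" using 3 by auto
  moreover have "((\<lambda>n. path_weight (p n) (j # l)) \<longlongrightarrow> path_weight p' (j # l)) F"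
    using 3 by (intro "3.IH") auto
  ultimately show ?case by (simp add: tendsto_mult)
qed simp_all

lemma q_transition_function_rate:
  assumes P: "q_transition_function q P" and h: "filterlim h (at_right 0) F"
  shows "((\<lambda>n. (P (h n) i j - (if i = j then 1 else 0)) / h n) \<longlongrightarrow> q i j) F"
proof -
  have "((\<lambda>t. P t i j) has_real_derivative q i j) (at 0 within {0..})" and "P 0 i j = (if i = j then 1 else 0)"
    using P by (simp_all add: q_transition_function_def)
  then have "((\<lambda>t. (P t i j - (if i = j then 1 else 0)) / t) \<longlongrightarrow> q i j) (at_right 0)"
    unfolding has_field_derivative_iff by (auto intro: tendsto_within_subset)
  from filterlim_compose[OF this h] show ?thesis .
qed

text \<open>Dividing numerator and denominator by \<open>h n\<close> turns them into difference
  quotients at 0, with limits \<open>q i j\<close> and \<open>- q i i\<close>.\<close>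

lemma jump_probability_tendsto:
  assumes P: "q_transition_function q P" and h: "filterlim h (at_right 0) F"
    and "i \<noteq> j" "q i i < 0"
  shows "((\<lambda>n. P (h n) i j / (1 - P (h n) i i)) \<longlongrightarrow> q i j / (- q i i)) F"
proof (rule Lim_transform_eventually)
  note rate = q_transition_function_rate[OF P h]
  show "((\<lambda>n. (P (h n) i j / h n) / (- ((P (h n) i i - 1) / h n))) \<longlongrightarrow> q i j / (- q i i)) F"
    using rate[of i j] rate[of i i] assms by (intro tendsto_divide tendsto_minus) auto
  have "\<forall>\<^sub>F n in F. h n > 0" using h by (auto simp: filterlim_at elim: eventually_mono)
  then show "\<forall>\<^sub>F n in F. (P (h n) i j / h n) / (- ((P (h n) i i - 1) / h n)) = P (h n) i j / (1 - P (h n) i i)"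
    by eventually_elim (auto simp: divide_simps algebra_simps)
qed

text \<open>The difference quotient of \<open>P t i i\<close> at 0 has a negative limit; this makes
  the geometric series over the sojourn converge for small mesh.\<close>

lemma holding_probability_less_1:
  assumes P: "q_transition_function q P" and h: "filterlim h (at_right 0) F" and "q i i < 0"
  shows "\<forall>\<^sub>F n in F. 0 \<le> P (h n) i i \<and> P (h n) i i < 1"
proof -
  have "((\<lambda>n. (P (h n) i i - 1) / h n) \<longlongrightarrow> q i i) F"
    using q_transition_function_rate[OF P h, of i i] by simp
  then have "\<forall>\<^sub>F n in F. (P (h n) i i - 1) / h n < 0"
    using assms(3) by (rule order_tendstoD)
  moreover have "\<forall>\<^sub>F n in F. h n > 0" using h by (auto simp: filterlim_at elim: eventually_mono)
  ultimately show ?thesis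
    by eventually_elim (use P in \<open>auto simp: q_transition_function_def divide_less_0_iff\<close>)
qed

section \<open>Passage from the grid to the path\<close>

context regular_ctmc
begin

lemma right_constant_path: "\<omega> \<in> space M \<Longrightarrow> right_constant (\<lambda>t. X t \<omega>)"
  using right_continuous by (simp add: right_constant_def)

lemma eventually_visits_iff_follows:
  assumes "\<omega> \<in> space M" "successively (\<noteq>) l"
  shows "\<forall>\<^sub>F n in sequentially. visits l (\<lambda>m. X (real m * (1 / real (Suc n))) \<omega>) = follows l (\<lambda>t. X t \<omega>)"
proof -
  obtain \<delta> where \<delta>: "\<delta> > 0" "\<And>h a. 0 < h \<Longrightarrow> h < \<delta> \<Longrightarrow> 0 \<le> a \<Longrightarrow> a < h \<Longrightarrow>
      visits l (\<lambda>m. X (a + real m * h) \<omega>) = follows l (\<lambda>t. X t \<omega>)"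
    using visits_skeleton[OF right_constant_path[OF assms(1)] assms(2)] by blast
  have "\<forall>\<^sub>F n in sequentially. 1 / real (Suc n) < \<delta>"
    using \<delta>(1) by (intro order_tendstoD[OF LIMSEQ_Suc[OF lim_1_over_n]])
  then show ?thesis
  proof eventually_elim
    fix n assume "1 / real (Suc n) < \<delta>"
    then show "visits l (\<lambda>m. X (real m * (1 / real (Suc n))) \<omega>) = follows l (\<lambda>t. X t \<omega>)"
      using \<delta>(2)[of "1 / real (Suc n)" 0] by simp
  qed
qed

lemma measurable_skeleton_visits:
  "Measurable.pred M (\<lambda>\<omega>. visits l (\<lambda>m. X (real m * (1 / real (Suc n))) \<omega>))"
  by (intro measurable_visits random_variable_X) simp

text \<open>\<open>follows\<close> quantifies over uncountably many times. Since the grid events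
  stabilise at every sample point, the event is their limes inferior, a countable
  combination.\<close>

lemma measurable_follows:
  assumes "successively (\<noteq>) l"
  shows "{\<omega> \<in> space M. follows l (\<lambda>t. X t \<omega>)} \<in> sets M"
proof -
  note [measurable] = measurable_skeleton_visits
  have "{\<omega> \<in> space M. follows l (\<lambda>t. X t \<omega>)} =
      {\<omega> \<in> space M. \<exists>N. \<forall>n\<in>{N..}. visits l (\<lambda>m. X (real m * (1 / real (Suc n))) \<omega>)}"
  proof (rule Collect_cong, rule conj_cong[OF refl])
    fix \<omega> assume "\<omega> \<in> space M"
    from eventually_visits_iff_follows[OF this assms]
    obtain N where "\<forall>n\<ge>N. visits l (\<lambda>m. X (real m * (1 / real (Suc n))) \<omega>) = follows l (\<lambda>t. X t \<omega>)"
      unfolding eventually_sequentially by blast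
    then show "follows l (\<lambda>t. X t \<omega>) \<longleftrightarrow>
        (\<exists>N. \<forall>n\<in>{N..}. visits l (\<lambda>m. X (real m * (1 / real (Suc n))) \<omega>))"
      by (metis atLeast_iff nat_le_linear)
  qed
  also have "\<dots> \<in> sets M" by measurable
  finally show ?thesis .
qed

text \<open>The grid probabilities have two limits that must agree: one by dominated convergence of
  the indicators, the other by convergence of the one-step jump ratios.\<close>

lemma prob_follows:
  assumes l: "successively (\<noteq>) l" "l \<noteq> []" "\<And>i. i \<in> set (butlast l) \<Longrightarrow> q i i < 0"
  shows "\<P>(\<omega> in M. follows l (\<lambda>t. X t \<omega>)) =
    \<P>(\<omega> in M. X 0 \<omega> = hd l) * path_weight (\<lambda>i j. q i j / (- q i i)) l"
proof (rule LIMSEQ_unique)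
  obtain P where P: "q_transition_function q P"
    and fdd: "\<And>n (t :: nat \<Rightarrow> real) i. 0 \<le> t 0 \<Longrightarrow> \<forall>m\<le>n. t m < t (Suc m) \<Longrightarrow>
      \<P>(\<omega> in M. \<forall>m\<le>Suc n. X (t m) \<omega> = i m) =
      \<P>(\<omega> in M. \<forall>m\<le>n. X (t m) \<omega> = i m) * P (t (Suc n) - t n) (i n) (i (Suc n))"
    using markov by blast
  define h where "h n = 1 / real (Suc n)" for n
  have h: "h n > 0" for n by (simp add: h_def)
  have "h \<longlonglongrightarrow> 0" unfolding h_def by (rule LIMSEQ_Suc[OF lim_1_over_n])
  then have h_lim: "filterlim h (at_right 0) sequentially"
    using h by (simp add: filterlim_at less_imp_neq[symmetric] h_def)
  let ?p = "\<lambda>n i j. P (h n) i j / (1 - P (h n) i i)"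
  let ?c = "\<P>(\<omega> in M. X 0 \<omega> = hd l)"
  define V where "V n = {\<omega> \<in> space M. visits l (\<lambda>m. X (real m * h n) \<omega>)}" for n
  define W where "W = {\<omega> \<in> space M. follows l (\<lambda>t. X t \<omega>)}"
  have meas: "V n \<in> sets M" "W \<in> sets M" for n
    using measurable_follows[OF l(1)] measurable_skeleton_visits
    by (simp_all add: V_def W_def h_def pred_def)
  have "(\<lambda>n. \<integral>\<omega>. indicator (V n) \<omega> \<partial>M :: real) \<longlonglongrightarrow> (\<integral>\<omega>. indicator W \<omega> \<partial>M)"
  proof (rule integral_dominated_convergence[where w = "\<lambda>_. 1"])
    show "AE \<omega> in M. (\<lambda>n. indicator (V n) \<omega> :: real) \<longlonglongrightarrow> indicator W \<omega>"
    proof (intro AE_I2 tendsto_eventually)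
      fix \<omega> assume \<omega>: "\<omega> \<in> space M"
      show "\<forall>\<^sub>F n in sequentially. (indicator (V n) \<omega> :: real) = indicator W \<omega>"
        using eventually_visits_iff_follows[OF \<omega> l(1)]
        by eventually_elim (use \<omega> in \<open>simp add: V_def W_def h_def indicator_def\<close>)
    qed
  qed (use meas in \<open>auto simp: indicator_def\<close>)
  then show "(\<lambda>n. prob (V n)) \<longlonglongrightarrow> \<P>(\<omega> in M. follows l (\<lambda>t. X t \<omega>))"
    using meas by (simp add: W_def)
  have "\<forall>\<^sub>F n in sequentially. \<forall>i\<in>set (butlast l). 0 \<le> P (h n) i i \<and> P (h n) i i < 1"
    using l(3) holding_probability_less_1[OF P h_lim] by (intro eventually_ball_finite) auto
  then have "\<forall>\<^sub>F n in sequentially. ?c * path_weight (?p n) l = prob (V n)"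
  proof eventually_elim
    fix n assume n: "\<forall>i\<in>set (butlast l). 0 \<le> P (h n) i i \<and> P (h n) i i < 1"
    \<comment> \<open>With \<open>K = 0\<close> the prefix only fixes the starting state.\<close>
    have "prob {\<omega> \<in> space M. (\<forall>m\<le>0. X (real m * h n) \<omega> = hd l) \<and> visits l (\<lambda>m. X (real (m + 0) * h n) \<omega>)} =
        prob {\<omega> \<in> space M. \<forall>m\<le>0. X (real m * h n) \<omega> = hd l} * path_weight (?p n) l"
    proof (rule prob_visits[where Y = "\<lambda>m. X (real m * h n)" and a = "\<lambda>_. hd l"])
      show "X (real m * h n) \<in> M \<rightarrow>\<^sub>M count_space UNIV" for m
        using h by (intro random_variable_X) (simp add: less_imp_le)
      show "prob {\<omega> \<in> space M. \<forall>m\<le>Suc k. X (real m * h n) \<omega> = a m} =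
          prob {\<omega> \<in> space M. \<forall>m\<le>k. X (real m * h n) \<omega> = a m} * P (h n) (a k) (a (Suc k))" for k a
        using fdd[of "\<lambda>m. real m * h n" k a] h by (simp add: algebra_simps)
    qed (use l n in auto)
    moreover have "{\<omega> \<in> space M. (\<forall>m\<le>0. X (real m * h n) \<omega> = hd l) \<and> visits l (\<lambda>m. X (real (m + 0) * h n) \<omega>)} = V n"
      using l(2) visits_start[of "hd l" "tl l"] by (auto simp: V_def)
    ultimately show "?c * path_weight (?p n) l = prob (V n)" by simp
  qed
  moreover have "(\<lambda>n. ?c * path_weight (?p n) l) \<longlonglongrightarrow> ?c * path_weight (\<lambda>i j. q i j / (- q i i)) l"
    using l(1,3) by (intro tendsto_mult tendsto_const tendsto_path_weight jump_probability_tendsto[OF P h_lim]) auto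
  ultimately show "(\<lambda>n. prob (V n)) \<longlonglongrightarrow> ?c * path_weight (\<lambda>i j. q i j / (- q i i)) l"
    by (rule Lim_transform_eventually[rotated])
qed

end

section \<open>Deaths along a path to extinction\<close>

fun extinction_path :: "nat list \<Rightarrow> bool" where
  "extinction_path [] \<longleftrightarrow> False"
| "extinction_path [i] \<longleftrightarrow> i = 0"
| "extinction_path (i # j # l) \<longleftrightarrow> i \<noteq> 0 \<and> i \<noteq> j \<and> extinction_path (j # l)"

fun deaths :: "nat list \<Rightarrow> nat" where
  "deaths (i # j # l) = (if i = Suc j then 1 else 0) + deaths (j # l)"
| "deaths _ = 0"

lemma extinction_path_successively: "extinction_path l \<Longrightarrow> successively (\<noteq>) l"
  by (induction l rule: induct_list012) auto

lemma extinction_path_butlast: "extinction_path l \<Longrightarrow> i \<in> set (butlast l) \<Longrightarrow> i \<noteq> 0"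
  by (induction l rule: induct_list012) (auto split: if_splits)

lemma extinction_path_0: "extinction_path (0 # l) \<longleftrightarrow> l = []"
  by (cases l) auto

lemma follows_ConsE:
  assumes "follows (i # j # l) f" "i \<noteq> j"
  obtains s where "0 < s" "\<And>r. 0 \<le> r \<Longrightarrow> r < s \<Longrightarrow> f r = f 0" "f s \<noteq> f 0" "f 0 = i" "f s = j"
    "follows (j # l) (\<lambda>r. f (s + r))"
proof -
  from assms(1) obtain s where s: "0 < s" "\<And>r. 0 \<le> r \<Longrightarrow> r < s \<Longrightarrow> f r = i"
      "follows (j # l) (\<lambda>r. f (s + r))"
    unfolding follows.simps(3) by blast
  have "f 0 = i" "f s = j" using s(1) s(2)[of 0] follows_start[OF s(3)] by simp_all
  then show thesis using that[of s] s assms(2) by metis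
qed

text \<open>The path determines the head and the first exit time; as 0 occurs only at the end,
  neither list can stop before the other.\<close>

lemma follows_extinction_path_unique:
  assumes "extinction_path l" "follows l f" "extinction_path l'" "follows l' f"
  shows "l = l'"
  using assms
proof (induction l arbitrary: l' f rule: induct_list012)
  case (2 i)
  then show ?case by (cases l') (auto simp: extinction_path_0 dest: follows_start)
next
  case (3 i j l)
  then have ij: "i \<noteq> j" by simp
  from 3(4) obtain s where s: "0 < s" "\<And>r. 0 \<le> r \<Longrightarrow> r < s \<Longrightarrow> f r = f 0" "f s \<noteq> f 0"
      "f 0 = i" "f s = j" "follows (j # l) (\<lambda>r. f (s + r))"
    by (rule follows_ConsE[OF _ ij]) blast
  obtain i' l1 where l1: "l' = i' # l1" using 3(5) by (cases l') auto
  then have "i' = i" using 3(6) s(4) follows_start by metis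
  then obtain j' l2 where l': "l' = i # j' # l2" using l1 3(3,5) by (cases l1) auto
  then have ij': "i \<noteq> j'" "extinction_path (j' # l2)" using 3(5) by auto
  have fol: "follows (j' # l2) (\<lambda>r. f (s + r))"
    using follows_exit[OF s(1-3) ij'(1), of l2] 3(6) unfolding l' by blast
  have "extinction_path (j # l)" using 3(3) by simp
  then have "j # l = j' # l2" by (rule "3.IH"(2)[OF _ s(6) ij'(2) fol])
  then show ?case by (simp add: l')
qed simp

text \<open>\<open>T\<close> is the sum of the holding times before 0, hence the first zero.
  Finiteness is carried through the induction because \<open>card\<close> is additive on finite
  disjoint sets.\<close>

lemma follows_extinction_path_deaths:
  fixes f :: "real \<Rightarrow> nat"
  assumes "extinction_path l" "follows l f"
  shows "\<exists>T\<ge>0. f T = 0 \<and> (\<forall>r. 0 \<le> r \<longrightarrow> r < T \<longrightarrow> f r \<noteq> 0) \<and>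
    finite {s \<in> {0<..T}. \<forall>\<^sub>F r in at_left s. f r = f s + 1} \<and>
    card {s \<in> {0<..T}. \<forall>\<^sub>F r in at_left s. f r = f s + 1} = deaths l"
  using assms
proof (induction l arbitrary: f rule: induct_list012)
  case (2 i)
  then show ?case by (intro exI[of _ 0]) simp
next
  case (3 i j l)
  then have ij: "i \<noteq> j" and i: "i \<noteq> 0" by simp_all
  from 3(4) obtain s where s: "0 < s" "\<And>r. 0 \<le> r \<Longrightarrow> r < s \<Longrightarrow> f r = f 0" "f s \<noteq> f 0"
      "f 0 = i" "f s = j" "follows (j # l) (\<lambda>r. f (s + r))"
    by (rule follows_ConsE[OF _ ij]) blast
  define D where "D f T = {s \<in> {0<..T}. \<forall>\<^sub>F r in at_left s. f r = f s + 1}" for f :: "real \<Rightarrow> nat" and T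
  obtain T where T: "T \<ge> 0" "f (s + T) = 0" "\<And>r. 0 \<le> r \<Longrightarrow> r < T \<Longrightarrow> f (s + r) \<noteq> 0"
      "finite (D (\<lambda>r. f (s + r)) T)" "card (D (\<lambda>r. f (s + r)) T) = deaths (j # l)"
    using "3.IH"(2)[OF _ s(6)] 3(3) unfolding D_def by auto
  have near: "\<forall>\<^sub>F r in at_left u. f r = i" if "0 < u" "u \<le> s" for u
  proof -
    have "\<forall>\<^sub>F r in at_left u. r \<in> {0<..<u}"
      using that by (intro eventually_at_left_real)
    then show ?thesis
      by eventually_elim (metis s(2,4) that(2) greaterThanLessThan_iff less_imp_le less_le_trans)
  qed
  \<comment> \<open>Just to the left of \<open>u\<close> the path is in state \<open>i\<close>, so
    \<open>f u\<close> alone decides whether a death occurs at \<open>u\<close>.\<close>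
  have death_iff: "(\<forall>\<^sub>F r in at_left u. f r = f u + 1) \<longleftrightarrow> i = f u + 1" if "0 < u" "u \<le> s" for u
  proof
    assume "\<forall>\<^sub>F r in at_left u. f r = f u + 1"
    with near[OF that] have "\<forall>\<^sub>F r in at_left u. i = f u + 1"
      by eventually_elim simp
    then show "i = f u + 1" by simp
  next
    assume "i = f u + 1"
    with near[OF that] show "\<forall>\<^sub>F r in at_left u. f r = f u + 1" by simp
  qed
  \<comment> \<open>Before \<open>s\<close> the path stays in \<open>i\<close> without deaths; after
    \<open>s\<close> its deaths are those of the restarted path, translated by
    \<open>s\<close>.\<close>
  have "D f (s + T) = (if i = Suc j then {s} else {}) \<union> (+) s ` D (\<lambda>r. f (s + r)) T"
  proof (rule set_eqI)
    fix u
    consider "u \<le> 0" | "0 < u" "u < s" | "u = s" | r where "u = s + r" "r > 0"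
      by (metis add_diff_cancel_left' add.commute diff_add_cancel diff_gt_0_iff_gt linorder_neqE_linordered_idom not_le)
    then show "u \<in> D f (s + T) \<longleftrightarrow> u \<in> (if i = Suc j then {s} else {}) \<union> (+) s ` D (\<lambda>r. f (s + r)) T"
    proof cases
      case 2
      then have "f u = i" using s(2)[of u] s(4) by simp
      then show ?thesis using 2 death_iff[of u] by (auto simp: D_def)
    next
      case 3
      then show ?thesis using s(1,5) death_iff[of s] T(1) by (auto simp: D_def)
    next
      case (4 r)
      then show ?thesis using s(1)
        by (auto simp: D_def eventually_at_left_shift image_iff)
    qed (use s(1) in \<open>auto simp: D_def\<close>)
  qed
  moreover have "s \<notin> (+) s ` D (\<lambda>r. f (s + r)) T" by (auto simp: D_def)
  ultimately have "finite (D f (s + T))" "card (D f (s + T)) = deaths (i # j # l)"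
    using T(4,5) by (auto simp: card_image)
  moreover have "f r \<noteq> 0" if "0 \<le> r" "r < s + T" for r
  proof (cases "r < s")
    case True
    then show ?thesis using s(2)[of r] s(4) i that by simp
  next
    case False
    then show ?thesis using T(3)[of "r - s"] that by simp
  qed
  ultimately show ?case
    unfolding D_def using T(1,2) s(1) by (intro exI[of _ "s + T"]) auto
qed simp

text \<open>Induction on the number of jumps up to \<open>T\<close>: restarting at the first exit
  time loses the jump there, and the initial state is put in front of the list found for the
  restarted path.\<close>

lemma follows_extinction_path_exists:
  fixes f :: "real \<Rightarrow> nat"
  assumes "right_constant f" "0 \<le> T" "f T = 0"
    and "finite {s \<in> {0<..T}. \<not> (\<forall>\<^sub>F r in at_left s. f r = f s)}"
  shows "\<exists>l. extinction_path l \<and> follows l f"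
proof -
  define J where "J f T = {s \<in> {0<..T}. \<not> (\<forall>\<^sub>F r in at_left s. f r = f s)}" for f :: "real \<Rightarrow> nat" and T
  have "finite (J f T)" using assms(4) by (simp add: J_def)
  then show ?thesis using assms(1-3)
  proof (induction "card (J f T)" arbitrary: f T rule: less_induct)
    case less
    show ?case
    proof (cases "f 0 = 0")
      case True
      then show ?thesis by (intro exI[of _ "[0]"]) simp
    next
      case False
      then obtain s where s: "0 < s" "s \<le> T" "\<And>r. 0 \<le> r \<Longrightarrow> r < s \<Longrightarrow> f r = f 0" "f s \<noteq> f 0"
        using first_exit[OF less(3,4)] less(5) by metis
      define g where "g = (\<lambda>r. f (s + r))"
      have "s \<in> J f T"
      proof -
        have "\<not> (\<forall>\<^sub>F r in at_left s. f r = f s)"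
        proof
          assume "\<forall>\<^sub>F r in at_left s. f r = f s"
          moreover have "\<forall>\<^sub>F r in at_left s. r \<in> {0<..<s}"
            using s(1) by (intro eventually_at_left_real)
          ultimately have "\<forall>\<^sub>F r in at_left s. False"
            by eventually_elim (metis s(3,4) greaterThanLessThan_iff less_imp_le)
          then show False by simp
        qed
        then show ?thesis using s(1,2) by (simp add: J_def)
      qed
      moreover have "(+) s ` J g (T - s) \<subseteq> J f T - {s}"
        using s(1) by (auto simp: J_def g_def eventually_at_left_shift)
      ultimately have sub: "(+) s ` J g (T - s) \<subset> J f T" by blast
      have fin: "finite (J g (T - s))"
        using finite_subset[OF psubset_imp_subset[OF sub] less(2)] by (simp add: finite_image_iff)
      have "card (J g (T - s)) < card (J f T)"
        using psubset_card_mono[OF less(2) sub] by (simp add: card_image)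
      moreover have "right_constant g"
        unfolding g_def using less(3) s(1) by (intro right_constant_shift) auto
      ultimately obtain l where l: "extinction_path l" "follows l g"
        using less(1)[of g "T - s"] fin s(2) less(5) by (auto simp: g_def)
      then obtain j l' where l': "l = j # l'" by (cases l) auto
      have "g 0 = j" using l(2) follows_start unfolding l' by fast
      then have j: "f 0 \<noteq> j" using s(4) by (auto simp: g_def)
      have "follows (f 0 # j # l') f"
        using follows_exit[OF s(1,3,4) j, of l'] l(2) by (simp add: l' g_def)
      moreover have "extinction_path (f 0 # j # l')"
        using False j l(1) by (simp add: l')
      ultimately show ?thesis by blast
    qed
  qed
qed

section \<open>Lists leading to 0 and the coefficients of the powers of \<open>R\<close>\<close>

definition skip_free_paths :: "nat \<Rightarrow> nat \<Rightarrow> nat list set" where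
  "skip_free_paths i k =
    {l. extinction_path l \<and> hd l = i \<and> deaths l = k \<and> successively (\<lambda>i j. i \<le> Suc j) l}"

text \<open>Downward steps have size one, so the descent from \<open>hd l\<close> to 0 takes at
  least \<open>hd l\<close> deaths.\<close>

lemma skip_free_path_deaths:
  "extinction_path l \<Longrightarrow> successively (\<lambda>i j. i \<le> Suc j) l \<Longrightarrow> hd l \<le> deaths l"
  by (induction l rule: induct_list012) auto

lemma skip_free_paths_empty: "k < i \<Longrightarrow> skip_free_paths i k = {}"
  using skip_free_path_deaths by (force simp: skip_free_paths_def)

lemma skip_free_paths_0: "skip_free_paths 0 k = (if k = 0 then {[0]} else {})"
proof -
  have *: "extinction_path l \<and> hd l = 0 \<longleftrightarrow> l = [0]" for l
    by (cases l) (auto simp: extinction_path_0)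
  show ?thesis unfolding skip_free_paths_def conj_assoc[symmetric] * by auto
qed

text \<open>Decomposition at the first jump: a death leads to \<open>n\<close> and uses up one of
  the \<open>k\<close> deaths; a birth leads to \<open>n + j\<close> with \<open>j \<ge> 2\<close>,
  and \<open>n + j \<le> k\<close> because that state still needs as many deaths.\<close>

lemma skip_free_paths_Suc:
  assumes "n < k"
  shows "skip_free_paths (Suc n) k = (#) (Suc n) ` skip_free_paths n (k - 1) \<union>
    (\<Union>j\<in>{2..k}. (#) (Suc n) ` skip_free_paths (n + j) k)" (is "_ = ?A")
proof (rule set_eqI)
  fix l
  show "l \<in> skip_free_paths (Suc n) k \<longleftrightarrow> l \<in> ?A"
  proof
    assume l: "l \<in> skip_free_paths (Suc n) k"
    then obtain i l' where l': "l = Suc n # i # l'"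
      by (cases l rule: extinction_path.cases) (auto simp: skip_free_paths_def)
    define m where "m = i # l'"
    have m: "extinction_path m" "successively (\<lambda>i j. i \<le> Suc j) m" "hd m = i"
      "n \<le> i" "i \<noteq> Suc n" "deaths m = (if i = n then k - 1 else k)"
      using l by (auto simp: skip_free_paths_def l' m_def)
    show "l \<in> ?A"
    proof (cases "i = n")
      case True
      then show ?thesis using m by (auto simp: skip_free_paths_def l' m_def)
    next
      case False
      then have "m \<in> skip_free_paths (n + (i - n)) k" "i - n \<in> {2..k}"
        using m skip_free_path_deaths[OF m(1,2)] by (auto simp: skip_free_paths_def)
      then show ?thesis unfolding l' m_def[symmetric] by blast
    qed
  next
    have Cons: "Suc n # m \<in> skip_free_paths (Suc n) (if i = n then Suc h else h)"
      if "m \<in> skip_free_paths i h" "n \<le> i" "i \<noteq> Suc n" for m i h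
      using that by (cases m) (auto simp: skip_free_paths_def)
    assume "l \<in> ?A"
    then show "l \<in> skip_free_paths (Suc n) k"
      using Cons[where i = n and h = "k - 1"] Cons[where h = k] assms by fastforce
  qed
qed

context offspring
begin

text \<open>From \<open>i \<ge> 1\<close> a jump to \<open>j\<close> replaces one individual by
  \<open>Suc j - i\<close> others; the diagonal is 0 because \<open>p 1 = 0\<close>.\<close>

definition jump_prob :: "nat \<Rightarrow> nat \<Rightarrow> real" where
  "jump_prob i j = (if i \<le> Suc j then p (Suc j - i) else 0)"

lemma path_weight_not_skip_free:
  "\<not> successively (\<lambda>i j. i \<le> Suc j) l \<Longrightarrow> path_weight jump_prob l = 0"
  by (induction l rule: induct_list012) (auto simp: jump_prob_def)

text \<open>The decomposition at the first jump gives the path sums the recursion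
  \<open>R_power_rec\<close>, with the same decreasing quantity \<open>2 * k - i\<close> and the
  same boundary values for \<open>i = 0\<close> and \<open>k < i\<close>.\<close>

lemma sum_skip_free_paths:
  "finite (skip_free_paths i k) \<and> (\<Sum>l\<in>skip_free_paths i k. path_weight jump_prob l) = (R ^ i) $ k"
proof (induction "2 * k - i" arbitrary: i k rule: less_induct)
  case less
  consider "k < i" | "i = 0" | "0 < i" "i \<le> k" by linarith
  then show ?case
  proof cases
    case 1
    then show ?thesis by (simp add: skip_free_paths_empty R_power_zero)
  next
    case 2
    then show ?thesis by (simp add: skip_free_paths_0)
  next
    case le: 3
    then obtain n where 3: "i = Suc n" "n < k" by (cases i) auto
    define A where "A = (#) (Suc n) ` skip_free_paths n (k - 1)"
    define B where "B j = (#) (Suc n) ` skip_free_paths (n + j) k" for j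
    have IH0: "finite (skip_free_paths n (k - 1))"
        "(\<Sum>l\<in>skip_free_paths n (k - 1). path_weight jump_prob l) = (R ^ n) $ (k - 1)"
      using less[of "k - 1" n] 3 by auto
    have IH: "finite (skip_free_paths (n + j) k)"
        "(\<Sum>l\<in>skip_free_paths (n + j) k. path_weight jump_prob l) = (R ^ (n + j)) $ k"
      if "j \<in> {2..k}" for j
      using less[of k "n + j"] 3 that by auto
    have weight: "(\<Sum>l\<in>(#) (Suc n) ` skip_free_paths m h. path_weight jump_prob l) =
        jump_prob (Suc n) m * (\<Sum>l\<in>skip_free_paths m h. path_weight jump_prob l)" for m h
    proof -
      have "path_weight jump_prob (Suc n # l) = jump_prob (Suc n) m * path_weight jump_prob l"
        if "l \<in> skip_free_paths m h" for l
        using that by (cases l) (auto simp: skip_free_paths_def)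
      then show ?thesis by (simp add: sum.reindex sum_distrib_left)
    qed
    have fin: "finite A" "\<And>j. j \<in> {2..k} \<Longrightarrow> finite (B j)"
      using IH0(1) IH(1) by (auto simp: A_def B_def)
    \<comment> \<open>The second entry of a list is \<open>n\<close> in \<open>A\<close> and
      \<open>n + j\<close> in \<open>B j\<close>, which separates these sets.\<close>
    have disj: "A \<inter> (\<Union>j\<in>{2..k}. B j) = {}" "\<And>j j'. j \<noteq> j' \<Longrightarrow> B j \<inter> B j' = {}"
      by (auto simp: A_def B_def skip_free_paths_def)
    have paths: "skip_free_paths i k = A \<union> (\<Union>j\<in>{2..k}. B j)"
      using skip_free_paths_Suc[OF 3(2)] by (simp add: 3(1) A_def B_def)
    have "(\<Sum>l\<in>skip_free_paths i k. path_weight jump_prob l) =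
        (\<Sum>l\<in>A. path_weight jump_prob l) + (\<Sum>j = 2..k. \<Sum>l\<in>B j. path_weight jump_prob l)"
      unfolding paths using fin disj
      by (subst sum.union_disjoint, simp, simp, simp, subst sum.UNION_disjoint) auto
    also have "\<dots> = p 0 * (R ^ n) $ (k - 1) + (\<Sum>j = 2..k. p j * (R ^ (n + j)) $ k)"
      unfolding A_def B_def weight IH0(2)
      by (intro arg_cong2[where f = "(+)"] sum.cong) (auto simp: IH(2) jump_prob_def)
    also have "\<dots> = (R ^ i) $ k"
      using R_power_rec[of k k n] 3 by (simp del: power_Suc)
    finally show ?thesis using fin by (simp add: paths)
  qed
qed

end

section \<open>The death number until extinction\<close>

context regular_ctmc
begin

text \<open>Non-explosion supplies the finitely many jumps from which the list is built; conversely,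
  a followed list ends with a visit to 0.\<close>

lemma extinction_time_finite_iff:
  assumes "\<omega> \<in> space M"
  shows "extinction_time X \<omega> < \<infinity> \<longleftrightarrow> (\<exists>l. extinction_path l \<and> follows l (\<lambda>t. X t \<omega>))"
proof -
  have "extinction_time X \<omega> < \<infinity> \<longleftrightarrow> (\<exists>T\<ge>0. X T \<omega> = 0)"
    unfolding extinction_time_def INF_less_iff by auto
  also have "\<dots> \<longleftrightarrow> (\<exists>l. extinction_path l \<and> follows l (\<lambda>t. X t \<omega>))"
    using follows_extinction_path_exists[OF right_constant_path[OF assms]] non_explosive[OF assms]
      follows_extinction_path_deaths[of _ "\<lambda>t. X t \<omega>"]
    by blast
  finally show ?thesis .
qed

lemma total_death_number_eq:
  assumes "extinction_path l" "follows l (\<lambda>t. X t \<omega>)"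
  shows "total_death_number X \<omega> = deaths l"
proof -
  obtain T where T: "0 \<le> T" "X T \<omega> = 0" "\<And>r. 0 \<le> r \<Longrightarrow> r < T \<Longrightarrow> X r \<omega> \<noteq> 0"
      "card {s \<in> {0<..T}. \<forall>\<^sub>F r in at_left s. X r \<omega> = X s \<omega> + 1} = deaths l"
    using follows_extinction_path_deaths[OF assms] by blast
  have "extinction_time X \<omega> = ereal T"
    unfolding extinction_time_def
  proof (rule antisym)
    show "(INF t\<in>{t. 0 \<le> t \<and> X t \<omega> = 0}. ereal t) \<le> ereal T"
      using T(1,2) by (intro INF_lower) simp
    show "ereal T \<le> (INF t\<in>{t. 0 \<le> t \<and> X t \<omega> = 0}. ereal t)"
      using T(3) by (intro INF_greatest) force
  qed
  then show ?thesis using T(4) by (simp add: total_death_number_def death_number_def)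
qed

lemma extinct_with_deaths_eq:
  "{\<omega> \<in> space M. total_death_number X \<omega> = k \<and> extinction_time X \<omega> < \<infinity>} =
    (\<Union>l\<in>{l. extinction_path l \<and> deaths l = k}. {\<omega> \<in> space M. follows l (\<lambda>t. X t \<omega>)})"
  using extinction_time_finite_iff total_death_number_eq by fastforce

text \<open>There are only countably many lists of natural numbers, so the union over lists is
  countable.\<close>

lemma measurable_extinct_with_deaths [measurable]:
  "{\<omega> \<in> space M. total_death_number X \<omega> = k \<and> extinction_time X \<omega> < \<infinity>} \<in> sets M"
  unfolding extinct_with_deaths_eq
  by (intro sets.countable_UN'' measurable_follows extinction_path_successively) auto

end

section \<open>Extinction of the weighted branching process with \<open>k\<close> deaths\<close>

locale wmbp = offspring b + regular_ctmc M X "wmbp_Q w b"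
  for b w :: "nat \<Rightarrow> real" and M :: "'a measure" and X +
  assumes w_pos: "i \<ge> 1 \<Longrightarrow> w i > 0"
    and init: "AE \<omega> in M. X 0 \<omega> = 1"
begin

text \<open>The weight \<open>w i\<close> cancels in the ratio of the rates, which leaves
  \<open>jump_prob\<close>; lists that do not start in 1 are null by the initial condition.\<close>

lemma prob_follows_extinction_path:
  assumes l: "extinction_path l"
  shows "\<P>(\<omega> in M. follows l (\<lambda>t. X t \<omega>)) = (if hd l = 1 then path_weight jump_prob l else 0)"
proof -
  have Q: "wmbp_Q w b i j / (- wmbp_Q w b i i) = jump_prob i j" if "i \<noteq> 0" "i \<noteq> j" for i j
    using w_pos[of i] b_neg that by (auto simp: wmbp_Q_def jump_prob_def p_def)
  have "path_weight (\<lambda>i j. wmbp_Q w b i j / (- wmbp_Q w b i i)) l = path_weight jump_prob l"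
    using l by (induction l rule: induct_list012) (simp_all add: Q del: divide_minus_right)
  moreover have "wmbp_Q w b i i < 0" if "i \<in> set (butlast l)" for i
    using extinction_path_butlast[OF l that] w_pos[of i] b_neg by (simp add: wmbp_Q_def mult_pos_neg)
  moreover have "l \<noteq> []" using l by auto
  ultimately have "\<P>(\<omega> in M. follows l (\<lambda>t. X t \<omega>)) =
      \<P>(\<omega> in M. X 0 \<omega> = hd l) * path_weight jump_prob l"
    using prob_follows[OF extinction_path_successively[OF l]] by simp
  moreover have "\<P>(\<omega> in M. X 0 \<omega> = hd l) = (if hd l = 1 then 1 else 0)"
  proof -
    have [measurable]: "X 0 \<in> M \<rightarrow>\<^sub>M count_space UNIV" by (rule random_variable_X) simp
    have "\<P>(\<omega> in M. X 0 \<omega> = hd l) = \<P>(\<omega> in M. hd l = 1)"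
      using init by (intro finite_measure_eq_AE) (auto elim: eventually_mono)
    then show ?thesis by (simp add: prob_space)
  qed
  ultimately show ?thesis by simp
qed

text \<open>Of the countably many lists with \<open>k\<close> deaths, those with a downward step
  larger than one or a start other than 1 are null. The finitely many others give disjoint events,
  whose weights add up to a coefficient of \<open>R\<close>.\<close>

lemma prob_extinct_with_deaths:
  "\<P>(\<omega> in M. total_death_number X \<omega> = k \<and> extinction_time X \<omega> < \<infinity>) = rho_seq b k"
proof -
  define C where "C l = {\<omega> \<in> space M. follows l (\<lambda>t. X t \<omega>)}" for l
  have C: "C l \<in> sets M" if "extinction_path l" for l
    unfolding C_def by (rule measurable_follows[OF extinction_path_successively[OF that]])
  define S where "S = {l. extinction_path l \<and> deaths l = k}"
  have sub: "skip_free_paths 1 k \<subseteq> S" by (auto simp: skip_free_paths_def S_def)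
  have "AE \<omega> in M. \<forall>l\<in>S - skip_free_paths 1 k. \<omega> \<notin> C l"
  proof (subst AE_ball_countable)
    show "\<forall>l\<in>S - skip_free_paths 1 k. AE \<omega> in M. \<omega> \<notin> C l"
    proof
      fix l assume l: "l \<in> S - skip_free_paths 1 k"
      then have "prob (C l) = 0"
        using path_weight_not_skip_free[of l] unfolding C_def
        by (subst prob_follows_extinction_path) (auto simp: S_def skip_free_paths_def)
      then show "AE \<omega> in M. \<omega> \<notin> C l"
        using C[of l] l by (simp add: S_def prob_eq_0)
    qed
  qed simp
  then have "AE \<omega> in M. \<omega> \<in> (\<Union>l\<in>S. C l) \<longleftrightarrow> \<omega> \<in> (\<Union>l\<in>skip_free_paths 1 k. C l)"
    by eventually_elim (use sub in blast)
  then have "prob (\<Union>l\<in>S. C l) = prob (\<Union>l\<in>skip_free_paths 1 k. C l)"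
    using C sub by (intro finite_measure_eq_AE sets.countable_UN'') (auto simp: S_def)
  also have "\<dots> = (\<Sum>l\<in>skip_free_paths 1 k. prob (C l))"
  proof (rule finite_measure_finite_Union)
    show "disjoint_family_on C (skip_free_paths 1 k)"
      unfolding disjoint_family_on_def C_def skip_free_paths_def
      using follows_extinction_path_unique by blast
  qed (use C sub sum_skip_free_paths in \<open>auto simp: S_def\<close>)
  also have "\<dots> = (\<Sum>l\<in>skip_free_paths 1 k. path_weight jump_prob l)"
    unfolding C_def by (intro sum.cong refl) (simp add: prob_follows_extinction_path skip_free_paths_def)
  also have "\<dots> = rho_seq b k"
    using sum_skip_free_paths[of 1 k] by (simp add: R_def)
  finally show ?thesis by (simp only: extinct_with_deaths_eq C_def S_def)
qed

lemma extinct_UN: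
  "{\<omega> \<in> space M. extinction_time X \<omega> < \<infinity>} =
    (\<Union>k. {\<omega> \<in> space M. total_death_number X \<omega> = k \<and> extinction_time X \<omega> < \<infinity>})"
  by auto

lemma prob_extinct: "\<P>(\<omega> in M. extinction_time X \<omega> < \<infinity>) = min_root b"
proof -
  have "(\<lambda>k. \<P>(\<omega> in M. total_death_number X \<omega> = k \<and> extinction_time X \<omega> < \<infinity>)) sums
      \<P>(\<omega> in M. extinction_time X \<omega> < \<infinity>)"
    unfolding extinct_UN
  proof (rule finite_measure_UNION)
    show "range (\<lambda>k. {\<omega> \<in> space M. total_death_number X \<omega> = k \<and> extinction_time X \<omega> < \<infinity>}) \<subseteq> sets M"
      by (intro image_subsetI measurable_extinct_with_deaths)
  qed (auto simp: disjoint_family_on_def)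
  then show ?thesis
    unfolding prob_extinct_with_deaths min_root_eq by (rule sums_unique)
qed

lemma rho_power_summable:
  assumes "\<bar>v\<bar> \<le> (1 :: real)"
  shows "summable (\<lambda>k. \<bar>rho_seq b k * v ^ k\<bar>)"
proof (rule summable_comparison_test_ev)
  show "\<forall>\<^sub>F k in sequentially. norm \<bar>rho_seq b k * v ^ k\<bar> \<le> rho_seq b k"
    using assms by (intro always_eventually allI)
      (simp add: abs_mult power_abs rho_nonneg mult_left_le power_le_one)
qed (rule rho_summable)

text \<open>Expanding over the value of the death number reduces the integrand to the measurable
  sets \<open>E k\<close>; absolute summability of \<open>rho_seq b k * v ^ k\<close> justifies
  exchanging sum and integral.\<close>

lemma integral_total_death_number:
  assumes v: "\<bar>v\<bar> \<le> (1 :: real)"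
  shows "(LINT \<omega>:{\<omega> \<in> space M. extinction_time X \<omega> < \<infinity>}|M. v ^ total_death_number X \<omega>) =
    (\<Sum>k. rho_seq b k * v ^ k)"
proof -
  define E where "E k = {\<omega> \<in> space M. total_death_number X \<omega> = k \<and> extinction_time X \<omega> < \<infinity>}" for k
  have [measurable]: "E k \<in> sets M" for k unfolding E_def by measurable
  have prob_E: "prob (E k) = rho_seq b k" for k
    unfolding E_def by (rule prob_extinct_with_deaths)
  let ?f = "\<lambda>k \<omega>. v ^ k * indicator (E k) \<omega> :: real"
  \<comment> \<open>At each sample point at most one summand is nonzero, so the series converges
    there and its sum is the integrand.\<close>
  have single: "?f k \<omega> = (if k = total_death_number X \<omega> then
      indicator {\<omega> \<in> space M. extinction_time X \<omega> < \<infinity>} \<omega> * v ^ total_death_number X \<omega> else 0)" for k \<omega>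
    by (auto simp: E_def indicator_def)
  have "(\<lambda>k. \<integral>\<omega>. ?f k \<omega> \<partial>M) sums (\<integral>\<omega>. (\<Sum>k. ?f k \<omega>) \<partial>M)"
  proof (rule sums_integral)
    show "integrable M (?f k)" for k 
      by (intro integrable_mult_right integrable_real_indicator) (auto simp: less_top[symmetric])
    have "summable (\<lambda>k. norm (?f k \<omega>))" for \<omega>
      unfolding single by (rule summable_finite[of "{total_death_number X \<omega>}"]) auto
    then show "AE \<omega> in M. summable (\<lambda>k. norm (?f k \<omega>))" by simp
    have "(\<integral>\<omega>. norm (?f k \<omega>) \<partial>M) = \<bar>rho_seq b k * v ^ k\<bar>" for k
      using rho_nonneg[of k] by (simp add: abs_mult prob_E)
    then show "summable (\<lambda>k. \<integral>\<omega>. norm (?f k \<omega>) \<partial>M)"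
      using rho_power_summable[OF v] by simp
  qed
  moreover have "(\<Sum>k. ?f k \<omega>) =
      indicator {\<omega> \<in> space M. extinction_time X \<omega> < \<infinity>} \<omega> * v ^ total_death_number X \<omega>" for \<omega>
    unfolding single by (rule sums_unique[symmetric, OF sums_single])
  ultimately show ?thesis
    by (simp add: set_lebesgue_integral_def prob_E sums_iff mult.commute)
qed

end

theorem corollary3p1:
  fixes M :: "'a measure" and X :: "real \<Rightarrow> 'a \<Rightarrow> nat" and b w :: "nat \<Rightarrow> real"
  assumes b_nonneg: "\<And>j. j \<noteq> 1 \<Longrightarrow> b j \<ge> 0"
    and b_neg: "0 < - b 1"
    and b_sum: "(b has_sum (- b 1)) {j. j \<noteq> 1}"
    and w_pos: "\<And>i. i \<ge> 1 \<Longrightarrow> w i > 0"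
    and b0_pos: "b 0 > 0"
    and wmbp: "regular_ctmc M X (wmbp_Q w b)"
    and init: "AE \<omega> in M. X 0 \<omega> = 1"
  shows "(\<forall>v::real. \<bar>v\<bar> \<le> 1 \<longrightarrow>
            summable (\<lambda>k. rho_seq b k * v ^ k) \<and>
            event_cond_exp M (\<lambda>\<omega>. v ^ total_death_number X \<omega>) (\<lambda>\<omega>. extinction_time X \<omega> < \<infinity>)
              = inverse (min_root b) * (\<Sum>k. rho_seq b k * v ^ k)) \<and>
         (\<forall>k::nat. \<P>(\<omega> in M. total_death_number X \<omega> = k \<bar> extinction_time X \<omega> < \<infinity>)
              = inverse (min_root b) * rho_seq b k)"
proof -
  interpret regular_ctmc M X "wmbp_Q w b" by (rule wmbp)
  interpret wmbp b w M X
    using b_nonneg b_neg b_sum w_pos init by unfold_locales auto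
  \<comment> \<open>Both claims follow on dividing by the extinction probability, which equals
    \<open>min_root b\<close>.\<close>
  show ?thesis
    using prob_extinct prob_extinct_with_deaths integral_total_death_number rho_power_summable
    by (auto simp: event_cond_exp_def cond_prob_def divide_inverse mult.commute
        intro: summable_rabs_cancel)
qed

end
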